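(* Every tree with $n$ nodes and maximum degree at most 4 has a planar L-shaped drawing on any set of $2n^{1.55}$ points in the plane in general orthogonal position.
   Context: A point set is in general orthogonal position if no two points share the same $x$- or $y$-coordinate. Points are unlabelled: vertices are placed at distinct points of the set, any vertex at any point, and not all points need be used. A planar L-shaped drawing is such a placement in which each edge is drawn as an orthogonal path consisting of one horizontal and one vertical segment (one bend), and no two edges intersect except at a common endpoint. The tree is unordered: the cyclic order of edges around vertices may be chosen freely. *)

theory Defs
  imports "HOL-Analysis.Analysis"
begin

type_synonym point = "real \<times> real"

text \<open>Simple undirected graphs: vertex set V, edge set E of 2-element vertex sets.\<close>

definition simple_graph :: "'a set \<Rightarrow> 'a set set \<Rightarrow> bool" where
  "simple_graph V E \<longleftrightarrow> finite V \<and> (\<forall>e\<in>E. \<exists>u v. u \<in> V \<and> v \<in> V \<and> u \<noteq> v \<and> e = {u, v})"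

definition adj :: "'a set set \<Rightarrow> 'a \<Rightarrow> 'a \<Rightarrow> bool" where
  "adj E u v \<longleftrightarrow> {u, v} \<in> E"

definition graph_connected :: "'a set \<Rightarrow> 'a set set \<Rightarrow> bool" where
  "graph_connected V E \<longleftrightarrow> (\<forall>u\<in>V. \<forall>v\<in>V. (u, v) \<in> {(x, y). adj E x y}\<^sup>*)"

text \<open>A cycle: a list of at least 3 distinct vertices, consecutive ones adjacent,
  and the last adjacent to the first.\<close>
definition has_cycle :: "'a set \<Rightarrow> 'a set set \<Rightarrow> bool" where
  "has_cycle V E \<longleftrightarrow> (\<exists>cs. length cs \<ge> 3 \<and> distinct cs \<and> set cs \<subseteq> V \<and>
      (\<forall>i. Suc i < length cs \<longrightarrow> adj E (cs ! i) (cs ! Suc i)) \<and>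
      adj E (last cs) (hd cs))"

definition is_tree :: "'a set \<Rightarrow> 'a set set \<Rightarrow> bool" where
  "is_tree V E \<longleftrightarrow> simple_graph V E \<and> V \<noteq> {} \<and> graph_connected V E \<and> \<not> has_cycle V E"

definition degree :: "'a set set \<Rightarrow> 'a \<Rightarrow> nat" where
  "degree E v = card {e \<in> E. v \<in> e}"

definition max_degree_le :: "'a set \<Rightarrow> 'a set set \<Rightarrow> nat \<Rightarrow> bool" where
  "max_degree_le V E d \<longleftrightarrow> (\<forall>v\<in>V. degree E v \<le> d)"

definition general_orthogonal_position :: "point set \<Rightarrow> bool" where
  "general_orthogonal_position P \<longleftrightarrow>
     (\<forall>p\<in>P. \<forall>q\<in>P. p \<noteq> q \<longrightarrow> fst p \<noteq> fst q \<and> snd p \<noteq> snd q)"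

text \<open>The L-shaped curve from p to q bending at b.\<close>
definition L_curve :: "point \<Rightarrow> point \<Rightarrow> point \<Rightarrow> point set" where
  "L_curve p b q = closed_segment p b \<union> closed_segment b q"

text \<open>A planar L-shaped drawing of (V,E) on point set P: an injective placement f of
  the vertices on points of P, and for each edge a bend point (one of the two corners
  of the axis-parallel box spanned by its endpoints), such that two distinct edges meet
  only at images of common endpoints and no edge passes through a vertex other than its
  endpoints.\<close>
definition edge_curve :: "('a \<Rightarrow> point) \<Rightarrow> ('a set \<Rightarrow> point) \<Rightarrow> 'a set \<Rightarrow> point set" where
  "edge_curve f bend e = (\<Union>{L_curve (f u) (bend e) (f v) | u v. e = {u, v}})"

definition planar_L_drawing ::
  "'a set \<Rightarrow> 'a set set \<Rightarrow> point set \<Rightarrow> ('a \<Rightarrow> point) \<Rightarrow> ('a set \<Rightarrow> point) \<Rightarrow> bool" where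
  "planar_L_drawing V E P f bend \<longleftrightarrow>
     inj_on f V \<and> f ` V \<subseteq> P \<and>
     (\<forall>e\<in>E. \<exists>u v. e = {u, v} \<and>
        bend e \<in> {(fst (f u), snd (f v)), (fst (f v), snd (f u))}) \<and>
     (\<forall>e1\<in>E. \<forall>e2\<in>E. e1 \<noteq> e2 \<longrightarrow>
        edge_curve f bend e1 \<inter> edge_curve f bend e2 \<subseteq> f ` (e1 \<inter> e2)) \<and>
     (\<forall>e\<in>E. edge_curve f bend e \<inter> f ` V \<subseteq> f ` e)"

definition has_planar_L_drawing :: "'a set \<Rightarrow> 'a set set \<Rightarrow> point set \<Rightarrow> bool" where
  "has_planar_L_drawing V E P \<longleftrightarrow> (\<exists>f bend. planar_L_drawing V E P f bend)"

end

theory Submission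
  imports Defs
begin

text \<open>The tree is rooted at a leaf, so every vertex has at most three children. Subtrees are drawn
  recursively, hanging from a ray that leaves an already placed vertex \<open>w\<close>, say to the right: the root
  of the subtree is joined to the ray by a vertical segment, so only points right of \<open>w\<close> and some
  height are needed, on either side of the ray. If the children of the root need \<open>J\<^sub>1\<close>, \<open>J\<^sub>2\<close>, \<open>J\<^sub>3\<close> points,
  take the rightmost \<open>J\<^sub>1\<close> points for the first one; of the other points at least half lie on the same
  side of the ray, and among \<open>J\<^sub>2 + J\<^sub>3 + 1\<close> points one can serve as root with the two other subtrees to
  its left and above it. Hence \<open>J\<^sub>1 + 2 J\<^sub>2 + 2 J\<^sub>3 + 1\<close> points suffice, which alone gives an exponent of
  \<open>log 2 3 > 1.55\<close>; the recursion is too expensive only when \<open>J\<^sub>1 \<approx> J\<^sub>2\<close> and \<open>J\<^sub>3\<close> is small.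

  In that case scan the points from left to right until one side of the ray, say the upper one,
  contains enough points for the root, its first subtree to the left and its small subtree above it.
  If the points passed below the ray are few, the second subtree fits to the right. Otherwise they are
  used as well: follow the heavy path of the second subtree, above the ray, to a vertex that splits
  evenly, and let one of its two large subtrees reach back below the ray to these points. If there
  is no such vertex near the root of the second subtree, then that subtree is cheaper than the worst
  case by a constant factor.\<close>

subsection \<open>Drawings of subtrees hanging from a point\<close>

text \<open>With x >= y >= z the sizes of the child subtrees as fractions of n, a bound of the form
  \<open>2 * n powr 1.55\<close> survives the recursion whenever x^1.55 + 2 y^1.55 + 2 z^1.55 <= 1.
  At x = y = 1/2 the left side is 3 / 2^1.55, about 1.0245: the defect is small, and it is repaired
  if the second subtree saves four percent, that is, needs only 192/100 instead of 2 times its size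
  to the power 1.55. A tree for which the recursion itself does not save four percent has either a
  child with at least 9/10 of its vertices or two children with at least 3/10 each and a third with
  at most 1/10. The first kind is a step along the heavy path, the second is the vertex that splits
  evenly. The path may be long: the cost of the drawing that reaches back is measured against the
  size of the current subtree, with factor 15/10, and the growth of this budget from a heavy child
  to its parent pays for the light subtrees. Since the fractions say nothing about the additive cost
  of a root, the induction carries the bound lowered by 1.\<close>

datatype 'a tr = Lf | Nd 'a "'a tr" "'a tr" "'a tr"

definition corners :: "point \<Rightarrow> point \<Rightarrow> point set" where
  "corners p q = {(fst p, snd q), (fst q, snd p)}"

text \<open>In \<open>hung t w P Q\<close> the set \<^term>\<open>Q\<close> is the part of the plane occupied by the drawing, including the
  edge from \<^term>\<open>w\<close> to the root. Each vertex owns the curve from its parent to itself without the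
  parent's point; a drawing is planar iff the sets owned by distinct vertices are disjoint.\<close>

fun hung :: "'a tr \<Rightarrow> point \<Rightarrow> point set \<Rightarrow> point set \<Rightarrow> bool" where
  "hung Lf w P Q \<longleftrightarrow> Q = {}"
| "hung (Nd r t1 t2 t3) w P Q \<longleftrightarrow> (\<exists>p k Q1 Q2 Q3. p \<in> P \<and> p \<noteq> w \<and> k \<in> corners w p \<and>
     hung t1 p P Q1 \<and> hung t2 p P Q2 \<and> hung t3 p P Q3 \<and>
     Q = (L_curve w k p - {w}) \<union> Q1 \<union> Q2 \<union> Q3 \<and>
     (L_curve w k p - {w}) \<inter> (Q1 \<union> Q2 \<union> Q3) = {} \<and> Q1 \<inter> Q2 = {} \<and> Q1 \<inter> Q3 = {} \<and> Q2 \<inter> Q3 = {})"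

declare hung.simps(2)[simp del]

lemma hung_mono: "hung t w P Q \<Longrightarrow> P \<subseteq> P' \<Longrightarrow> hung t w P' Q"
proof (induction t arbitrary: w Q)
  case (Nd r t1 t2 t3)
  from Nd.prems(1) obtain p k Q1 Q2 Q3 where
    *: "p \<in> P" "p \<noteq> w" "k \<in> corners w p" "hung t1 p P Q1" "hung t2 p P Q2" "hung t3 p P Q3"
     "Q = (L_curve w k p - {w}) \<union> Q1 \<union> Q2 \<union> Q3"
     "(L_curve w k p - {w}) \<inter> (Q1 \<union> Q2 \<union> Q3) = {}" "Q1 \<inter> Q2 = {}" "Q1 \<inter> Q3 = {}" "Q2 \<inter> Q3 = {}"
    unfolding hung.simps by metis
  have "hung t1 p P' Q1" "hung t2 p P' Q2" "hung t3 p P' Q3"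
    using * Nd.IH Nd.prems(2) by auto
  with * Nd.prems(2) show ?case unfolding hung.simps by blast
qed simp

lemma hung_swap12: "hung (Nd r t1 t2 t3) w P Q \<Longrightarrow> hung (Nd r t2 t1 t3) w P Q"
proof -
  assume "hung (Nd r t1 t2 t3) w P Q"
  then obtain p k Q1 Q2 Q3 where
    *: "p \<in> P" "p \<noteq> w" "k \<in> corners w p" "hung t1 p P Q1" "hung t2 p P Q2" "hung t3 p P Q3"
     "Q = (L_curve w k p - {w}) \<union> Q1 \<union> Q2 \<union> Q3"
     "(L_curve w k p - {w}) \<inter> (Q1 \<union> Q2 \<union> Q3) = {}" "Q1 \<inter> Q2 = {}" "Q1 \<inter> Q3 = {}" "Q2 \<inter> Q3 = {}"
    unfolding hung.simps by metis
  show ?thesis unfolding hung.simps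
    by (rule exI[of _ p], rule exI[of _ k], rule exI[of _ Q2], rule exI[of _ Q1], rule exI[of _ Q3])
       (use * in blast)
qed

lemma hung_swap23: "hung (Nd r t1 t2 t3) w P Q \<Longrightarrow> hung (Nd r t1 t3 t2) w P Q"
proof -
  assume "hung (Nd r t1 t2 t3) w P Q"
  then obtain p k Q1 Q2 Q3 where
    *: "p \<in> P" "p \<noteq> w" "k \<in> corners w p" "hung t1 p P Q1" "hung t2 p P Q2" "hung t3 p P Q3"
     "Q = (L_curve w k p - {w}) \<union> Q1 \<union> Q2 \<union> Q3"
     "(L_curve w k p - {w}) \<inter> (Q1 \<union> Q2 \<union> Q3) = {}" "Q1 \<inter> Q2 = {}" "Q1 \<inter> Q3 = {}" "Q2 \<inter> Q3 = {}"
    unfolding hung.simps by metis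
  show ?thesis unfolding hung.simps
    by (rule exI[of _ p], rule exI[of _ k], rule exI[of _ Q1], rule exI[of _ Q3], rule exI[of _ Q2])
       (use * in blast)
qed

text \<open>Linear maps carry segments to segments, so an injective one that respects corners
  carries drawings to drawings. With the two reflections and the exchange of coordinates, a ray in
  any of the four directions reduces to a ray to the right.\<close>

lemma hung_image:
  assumes lin: "linear s" and inj: "inj s"
    and cor: "\<And>p q. corners (s p) (s q) = s ` corners p q"
    and "hung t w P Q"
  shows "hung t (s w) (s ` P) (s ` Q)"
  using assms(4)
proof (induction t arbitrary: w Q)
  case (Nd r t1 t2 t3)
  then obtain p k Q1 Q2 Q3 where
    *: "p \<in> P" "p \<noteq> w" "k \<in> corners w p" "hung t1 p P Q1" "hung t2 p P Q2" "hung t3 p P Q3"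
     "Q = (L_curve w k p - {w}) \<union> Q1 \<union> Q2 \<union> Q3"
     "(L_curve w k p - {w}) \<inter> (Q1 \<union> Q2 \<union> Q3) = {}" "Q1 \<inter> Q2 = {}" "Q1 \<inter> Q3 = {}" "Q2 \<inter> Q3 = {}"
    unfolding hung.simps by metis
  have L: "L_curve (s w) (s k) (s p) - {s w} = s ` (L_curve w k p - {w})"
    unfolding L_curve_def closed_segment_linear_image[OF lin]
    using inj by (simp add: image_Un image_set_diff)
  show ?case unfolding hung.simps
  proof (rule exI[of _ "s p"], rule exI[of _ "s k"], rule exI[of _ "s ` Q1"], rule exI[of _ "s ` Q2"],
      rule exI[of _ "s ` Q3"], intro conjI)
    show "s k \<in> corners (s w) (s p)" using cor *(3) by auto
    show "s p \<noteq> s w" using * inj by (simp add: inj_eq)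
    show "s ` Q = L_curve (s w) (s k) (s p) - {s w} \<union> s ` Q1 \<union> s ` Q2 \<union> s ` Q3"
      unfolding L *(7) by blast
    show "(L_curve (s w) (s k) (s p) - {s w}) \<inter> (s ` Q1 \<union> s ` Q2 \<union> s ` Q3) = {}"
      unfolding L using *(8) inj by (simp add: image_Un[symmetric] image_Int[OF inj, symmetric] del: image_Un)
    show "s ` Q1 \<inter> s ` Q2 = {}" "s ` Q1 \<inter> s ` Q3 = {}" "s ` Q2 \<inter> s ` Q3 = {}"
      using *(9-) by (simp_all add: image_Int[OF inj, symmetric])
  qed (use * Nd.IH in auto)
qed simp

section \<open>Symmetries of the plane and rays in four directions\<close>

definition negx :: "point \<Rightarrow> point" where "negx p = (- fst p, snd p)"
definition negy :: "point \<Rightarrow> point" where "negy p = (fst p, - snd p)"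

lemma fst_snd_negs [simp]:
  "fst (negx p) = - fst p" "snd (negx p) = snd p" "fst (negy p) = fst p" "snd (negy p) = - snd p"
  by (simp_all add: negx_def negy_def)

lemma invols [simp]: "negx (negx p) = p" "negy (negy p) = p"
  by (simp_all add: prod_eq_iff)

lemma invols_image [simp]: "negx ` negx ` S = S" "negy ` negy ` S = S" "prod.swap ` prod.swap ` S = S"
  for S :: "point set"
  by (simp_all add: image_image)

lemma inj_invols: "inj negx" "inj negy"
  by (metis injI invols(1)) (metis injI invols(2))

lemma hung_negx: "hung t w P Q \<Longrightarrow> hung t (negx w) (negx ` P) (negx ` Q)"
  by (rule hung_image[OF _ inj_invols(1)]) (auto simp: corners_def negx_def intro!: linearI)

lemma hung_negy: "hung t w P Q \<Longrightarrow> hung t (negy w) (negy ` P) (negy ` Q)"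
  by (rule hung_image[OF _ inj_invols(2)]) (auto simp: corners_def negy_def intro!: linearI)

lemma hung_swap: "hung t w P Q \<Longrightarrow> hung t (prod.swap w) (prod.swap ` P) (prod.swap ` Q)"
  by (rule hung_image) (auto simp: corners_def intro!: linearI)

abbreviation inbox :: "real \<Rightarrow> real \<Rightarrow> real \<Rightarrow> real \<Rightarrow> point \<Rightarrow> bool" where
  "inbox a b c d p \<equiv> a < fst p \<and> fst p < b \<and> c < snd p \<and> snd p < d"

abbreviation (input) gop where "gop \<equiv> general_orthogonal_position"

lemma gop_subset: "gop S \<Longrightarrow> T \<subseteq> S \<Longrightarrow> gop T"
  unfolding general_orthogonal_position_def by blast

lemma gop_negx: "gop S \<Longrightarrow> gop (negx ` S)"
  and gop_negy: "gop S \<Longrightarrow> gop (negy ` S)"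
  and gop_swap: "gop S \<Longrightarrow> gop (prod.swap ` S)"
  unfolding general_orthogonal_position_def by auto

lemma gop_inj: "gop S \<Longrightarrow> inj_on fst S" "gop S \<Longrightarrow> inj_on snd S"
  unfolding general_orthogonal_position_def inj_on_def by auto

lemma gop_notin:
  assumes "gop S" "u \<in> S" "T \<subseteq> S" "u \<notin> T"
  shows "fst u \<notin> fst ` T" "snd u \<notin> snd ` T"
  using assms unfolding general_orthogonal_position_def image_iff by (metis subsetD)+

text \<open>A contract for composing drawings: outside the box the drawing occupies only the stretch
  of the ray between \<open>w\<close> and the side \<open>a\<close>. Subtrees with disjoint boxes
  and unobstructed rays are therefore disjoint, whatever happens inside the boxes.\<close>

definition sufficient :: "'a tr \<Rightarrow> nat \<Rightarrow> bool" where
  "sufficient t N \<longleftrightarrow> (\<forall>w S a b c d. finite S \<and> gop S \<and> snd w \<notin> snd ` S \<and> N \<le> card S \<and>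
     (\<forall>p\<in>S. inbox a b c d p) \<and> fst w \<le> a \<and> c < snd w \<and> snd w < d \<longrightarrow>
     (\<exists>Q. hung t w S Q \<and> (\<forall>q\<in>Q. snd q = snd w \<and> fst w < fst q \<and> fst q \<le> a \<or> inbox a b c d q)))"

lemma sufficient_right:
  assumes "sufficient t N" "finite S" "gop S" "snd w \<notin> snd ` S" "N \<le> card S" "\<forall>p\<in>S. inbox a b c d p"
    "fst w \<le> a" "c < snd w" "snd w < d"
  shows "\<exists>Q. hung t w S Q \<and> (\<forall>q\<in>Q. snd q = snd w \<and> fst w < fst q \<and> fst q \<le> a \<or> inbox a b c d q)"
  using assms(1)[unfolded sufficient_def, rule_format, of S w a b c d] assms(2-) by blast

lemma sufficient_left:
  assumes "sufficient t N" "finite S" "gop S" "snd w \<notin> snd ` S" "N \<le> card S" "\<forall>p\<in>S. inbox a b c d p"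
    "b \<le> fst w" "c < snd w" "snd w < d"
  shows "\<exists>Q. hung t w S Q \<and> (\<forall>q\<in>Q. snd q = snd w \<and> b \<le> fst q \<and> fst q < fst w \<or> inbox a b c d q)"
proof -
  have "\<exists>Q. hung t (negx w) (negx ` S) Q \<and> (\<forall>q\<in>Q. snd q = snd (negx w) \<and> fst (negx w) < fst q \<and> fst q \<le> -b
    \<or> inbox (-b) (-a) c d q)"
    using assms by (intro sufficient_right[where N=N]) (auto simp: gop_negx card_image inj_on_subset[OF inj_invols(1)] image_image)
  then obtain Q where Q: "hung t (negx w) (negx ` S) Q" "\<forall>q\<in>Q. snd q = snd (negx w) \<and> fst (negx w) < fst q \<and> fst q \<le> -b
    \<or> inbox (-b) (-a) c d q" by blast
  have "hung t w S (negx ` Q)" using hung_negx[OF Q(1)] by simp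
  with Q(2) show ?thesis by (intro exI[of _ "negx ` Q"]) auto
qed

lemma sufficient_up:
  assumes "sufficient t N" "finite S" "gop S" "fst w \<notin> fst ` S" "N \<le> card S" "\<forall>p\<in>S. inbox a b c d p"
    "snd w \<le> c" "a < fst w" "fst w < b"
  shows "\<exists>Q. hung t w S Q \<and> (\<forall>q\<in>Q. fst q = fst w \<and> snd w < snd q \<and> snd q \<le> c \<or> inbox a b c d q)"
proof -
  have "\<exists>Q. hung t (prod.swap w) (prod.swap ` S) Q \<and> (\<forall>q\<in>Q. snd q = snd (prod.swap w) \<and> fst (prod.swap w) < fst q \<and> fst q \<le> c
    \<or> inbox c d a b q)"
    using assms by (intro sufficient_right[where N=N]) (auto simp: gop_swap card_image image_image)
  then obtain Q where Q: "hung t (prod.swap w) (prod.swap ` S) Q" "\<forall>q\<in>Q. snd q = snd (prod.swap w) \<and> fst (prod.swap w) < fst q \<and> fst q \<le> c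
    \<or> inbox c d a b q" by blast
  have "hung t w S (prod.swap ` Q)" using hung_swap[OF Q(1)] by simp
  with Q(2) show ?thesis by (intro exI[of _ "prod.swap ` Q"]) auto
qed

lemma sufficient_down:
  assumes "sufficient t N" "finite S" "gop S" "fst w \<notin> fst ` S" "N \<le> card S" "\<forall>p\<in>S. inbox a b c d p"
    "d \<le> snd w" "a < fst w" "fst w < b"
  shows "\<exists>Q. hung t w S Q \<and> (\<forall>q\<in>Q. fst q = fst w \<and> d \<le> snd q \<and> snd q < snd w \<or> inbox a b c d q)"
proof -
  have "\<exists>Q. hung t (negy w) (negy ` S) Q \<and> (\<forall>q\<in>Q. fst q = fst (negy w) \<and> snd (negy w) < snd q \<and> snd q \<le> -d
    \<or> inbox a b (-d) (-c) q)"
    using assms by (intro sufficient_up[where N=N]) (auto simp: gop_negy card_image inj_on_subset[OF inj_invols(2)] image_image)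
  then obtain Q where Q: "hung t (negy w) (negy ` S) Q" "\<forall>q\<in>Q. fst q = fst (negy w) \<and> snd (negy w) < snd q \<and> snd q \<le> -d
    \<or> inbox a b (-d) (-c) q" by blast
  have "hung t w S (negy ` Q)" using hung_negy[OF Q(1)] by simp
  with Q(2) show ?thesis by (intro exI[of _ "negy ` Q"]) auto
qed

lemma sufficient_mono: "sufficient t N \<Longrightarrow> N \<le> M \<Longrightarrow> sufficient t M"
  unfolding sufficient_def using le_trans by blast

lemma sufficient_Lf: "sufficient Lf N"
  unfolding sufficient_def by auto

section \<open>Separating points by axis-parallel lines\<close>

lemma dense_avoid:
  fixes F :: "real set"
  assumes "finite F" "lo < hi"
  obtains x where "lo < x" "x < hi" "x \<notin> F"
proof -
  have "\<not> {lo<..<hi} \<subseteq> F" using assms finite_subset infinite_Ioo by blast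
  then obtain x where "x \<in> {lo<..<hi}" "x \<notin> F" by blast
  then show ?thesis by (intro that[of x]) auto
qed

text \<open>Induction on the maximum \<open>b\<close>: if \<open>b\<close> is not among the
  \<open>k\<close> smallest, the value sought lies below \<open>b\<close>, which becomes the new
  upper end; otherwise any value between \<open>b\<close> and \<open>hi\<close> outside
  \<open>F\<close> will do.\<close>

lemma separate_reals:
  fixes A :: "real set"
  assumes "finite F" "finite A" "lo < hi" "\<forall>x\<in>A. lo < x \<and> x < hi" "k \<le> card A"
  shows "\<exists>x. lo < x \<and> x < hi \<and> x \<notin> F \<and> card {a\<in>A. a < x} = k"
  using assms(2-)
proof (induction A arbitrary: hi rule: finite_linorder_max_induct)
  case empty
  then show ?case using dense_avoid[OF assms(1), of lo hi] by auto
next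
  case (insert b A)
  show ?case
  proof (cases "k \<le> card A")
    case True
    then obtain x where "lo < x" "x < b" "x \<notin> F" "card {a\<in>A. a < x} = k"
      using insert.IH[of b] insert.prems insert.hyps by auto
    moreover have "{a \<in> insert b A. a < x} = {a\<in>A. a < x}" using \<open>x < b\<close> by auto
    ultimately show ?thesis using insert.prems by (intro exI[of _ x]) auto
  next
    case False
    have "b \<notin> A" using insert.hyps by auto
    then have k: "k = card (insert b A)" using False insert.prems insert.hyps by simp
    obtain x where x: "b < x" "x < hi" "x \<notin> F"
      using dense_avoid[OF assms(1), of b hi] insert.prems by auto
    then have "{a \<in> insert b A. a < x} = insert b A" using insert.hyps by auto
    then show ?thesis using x k insert.prems insert.hyps by (intro exI[of _ x]) auto
  qed
qed

text \<open>A scan counts the points on one side of a ray only, but the separating line must also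
  miss the points on the other side. Hence the two sets \<open>S\<close> and
  \<open>T\<close>.\<close>

lemma separate_avoiding:
  assumes "finite T" "S \<subseteq> T" "inj_on f S" "lo < (hi::real)" "\<forall>p\<in>S. lo < f p \<and> f p < hi" "k \<le> card S"
  obtains x where "lo < x" "x < hi" "\<forall>p\<in>T. f p \<noteq> x" "card {p\<in>S. f p < x} = k"
    "card {p\<in>S. x < f p} = card S - k"
proof -
  have fin: "finite S" using assms finite_subset by blast
  obtain x where x: "lo < x" "x < hi" "x \<notin> f ` T" "card {a\<in>f ` S. a < x} = k"
    using separate_reals[of "f ` T" "f ` S" lo hi k] assms fin by (auto simp: card_image)
  have "{a\<in>f ` S. a < x} = f ` {p\<in>S. f p < x}" by auto
  then have c: "card {p\<in>S. f p < x} = k"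
    using x(4) assms(3) by (simp add: card_image inj_on_subset)
  have "{p\<in>S. x < f p} = S - {p\<in>S. f p < x}" using x(3) assms(2) by (auto simp: not_less le_less)
  then have "card {p\<in>S. x < f p} = card S - k"
    using c fin by (simp add: card_Diff_subset)
  then show ?thesis using that x c by blast
qed

lemma separate:
  assumes "finite S" "inj_on f S" "lo < (hi::real)" "\<forall>p\<in>S. lo < f p \<and> f p < hi" "k \<le> card S"
  obtains x where "lo < x" "x < hi" "\<forall>p\<in>S. f p \<noteq> x" "card {p\<in>S. f p < x} = k"
    "card {p\<in>S. x < f p} = card S - k"
  using separate_avoiding[OF assms(1) order_refl assms(2-5)] by blast

section \<open>Placing a root and its three subtrees\<close>

lemma L_curve_horizontal_first:
  assumes "q \<in> L_curve w (fst p, snd w) p" "q \<noteq> w" "fst w < fst p"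
  shows "snd q = snd w \<and> fst w < fst q \<and> fst q \<le> fst p \<or>
    fst q = fst p \<and> min (snd w) (snd p) \<le> snd q \<and> snd q \<le> max (snd w) (snd p)"
proof -
  have *: "fst x \<in> closed_segment (fst y) (fst z) \<and> snd x \<in> closed_segment (snd y) (snd z)"
    if "x \<in> closed_segment y z" for x y z :: point
    using that closed_segment_linear_image[OF linear_fst, of y z]
      closed_segment_linear_image[OF linear_snd, of y z] by blast
  from assms(1) consider "q \<in> closed_segment w (fst p, snd w)" | "q \<in> closed_segment (fst p, snd w) p"
    unfolding L_curve_def by blast
  then show ?thesis
  proof cases
    case 1
    have "fst q \<in> {fst w..fst p}" "snd q = snd w"
      using *[OF 1] assms(3) by (auto simp: closed_segment_eq_real_ivl)
    then show ?thesis using assms(2) by (auto simp: prod_eq_iff)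
  next
    case 2
    then show ?thesis using *[OF 2] by (auto simp: closed_segment_eq_real_ivl split: if_splits)
  qed
qed

text \<open>With the bend at \<open>(fst p, snd w)\<close> the edge follows the ray of
  \<open>w\<close> and then runs vertically to \<open>p\<close>. Placing a root thus reduces to
  keeping the subtrees off these two pieces and off each other; every root placement below goes
  through this rule.\<close>

lemma hung_Nd_right:
  assumes "p \<in> P" "fst w < fst p" "hung t1 p P Q1" "hung t2 p P Q2" "hung t3 p P Q3"
    and sep: "\<And>q. q \<in> Q1 \<union> Q2 \<union> Q3 \<Longrightarrow> \<not> (snd q = snd w \<and> fst w < fst q \<and> fst q \<le> fst p)"
      "\<And>q. q \<in> Q1 \<union> Q2 \<union> Q3 \<Longrightarrow> \<not> (fst q = fst p \<and> min (snd w) (snd p) \<le> snd q \<and> snd q \<le> max (snd w) (snd p))"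
    and disj: "Q1 \<inter> Q2 = {}" "Q1 \<inter> Q3 = {}" "Q2 \<inter> Q3 = {}"
  obtains Q where "hung (Nd r t1 t2 t3) w P Q"
    "\<And>q. q \<in> Q \<Longrightarrow> q \<in> Q1 \<or> q \<in> Q2 \<or> q \<in> Q3 \<or> snd q = snd w \<and> fst w < fst q \<and> fst q \<le> fst p \<or>
       fst q = fst p \<and> min (snd w) (snd p) \<le> snd q \<and> snd q \<le> max (snd w) (snd p)"
proof (rule that)
  let ?L = "L_curve w (fst p, snd w) p - {w}"
  have L: "snd q = snd w \<and> fst w < fst q \<and> fst q \<le> fst p \<or>
       fst q = fst p \<and> min (snd w) (snd p) \<le> snd q \<and> snd q \<le> max (snd w) (snd p)" if "q \<in> ?L" for q
    using L_curve_horizontal_first[of q w p] that assms(2) by blast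
  show "hung (Nd r t1 t2 t3) w P (?L \<union> Q1 \<union> Q2 \<union> Q3)"
    unfolding hung.simps
  proof (intro exI conjI)
    show "?L \<inter> (Q1 \<union> Q2 \<union> Q3) = {}"
    proof (rule Int_emptyI)
      fix q assume "q \<in> ?L" "q \<in> Q1 \<union> Q2 \<union> Q3"
      then show False using L[of q] sep[of q] by argo
    qed
    show "(fst p, snd w) \<in> corners w p" by (simp add: corners_def)
    show "p \<noteq> w" using assms(2) by auto
  qed (use assms in auto)
  show "q \<in> Q1 \<or> q \<in> Q2 \<or> q \<in> Q3 \<or> snd q = snd w \<and> fst w < fst q \<and> fst q \<le> fst p \<or>
       fst q = fst p \<and> min (snd w) (snd p) \<le> snd q \<and> snd q \<le> max (snd w) (snd p)"
    if "q \<in> ?L \<union> Q1 \<union> Q2 \<union> Q3" for q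
    using L that by blast
qed

lemma obtain_max_on:
  fixes f :: "'b \<Rightarrow> real"
  assumes "finite S" "S \<noteq> {}" "inj_on f S"
  obtains u where "u \<in> S" "\<And>p. p \<in> S \<Longrightarrow> p \<noteq> u \<Longrightarrow> f p < f u"
proof -
  have "Max (f ` S) \<in> f ` S" using assms(1,2) by simp
  then obtain u where u: "u \<in> S" "f u = Max (f ` S)" by auto
  show ?thesis
  proof (rule that[OF u(1)])
    fix p assume p: "p \<in> S" "p \<noteq> u"
    have "f p \<le> f u" using p(1) assms(1) by (simp add: u(2))
    moreover have "f p \<noteq> f u" using inj_onD[OF assms(3), of p u] p u(1) by blast
    ultimately show "f p < f u" by simp
  qed
qed

text \<open>The two subtrees leave \<open>u\<close> to the left and upwards, so that the ray to the
  right and the vertical line below \<open>u\<close> stay free, for a third subtree and for the edge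
  from the parent. The line at height \<open>y\<close> reserves \<open>Nb\<close> points above it,
  and \<open>u\<close> is the rightmost point below it, so the other low points all lie to its
  left.\<close>

lemma corner:
  assumes "sufficient ta Na" "sufficient tb Nb" "finite A" "gop A" "Na + Nb + 1 \<le> card A" "\<forall>p\<in>A. inbox a b c d p"
  obtains u Qa Qb where "u \<in> A" "hung ta u A Qa" "hung tb u A Qb" "Qa \<inter> Qb = {}"
    "\<forall>q\<in>Qa. inbox a b c d q \<and> fst q < fst u" "\<forall>q\<in>Qb. inbox a b c d q \<and> snd u < snd q"
proof -
  have "A \<noteq> {}" using assms(5) by auto
  then obtain p0 where p0: "inbox a b c d p0" using assms(6) by blast
  then have "c < d" by linarith
  obtain y where y: "c < y" "y < d" "\<forall>p\<in>A. snd p \<noteq> y" "card {p\<in>A. snd p < y} = card A - Nb"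
    "card {p\<in>A. y < snd p} = card A - (card A - Nb)"
    by (rule separate[of A snd c d "card A - Nb"]) (use assms \<open>c < d\<close> gop_inj in auto)
  define lo where "lo = {p\<in>A. snd p < y}"
  define hi where "hi = {p\<in>A. y < snd p}"
  have lohi: "lo \<subseteq> A" "hi \<subseteq> A" "finite lo" "finite hi" "Na + 1 \<le> card lo" "Nb \<le> card hi"
    using y assms by (auto simp: lo_def hi_def)
  obtain u where u: "u \<in> lo" "\<And>p. p \<in> lo \<Longrightarrow> p \<noteq> u \<Longrightarrow> fst p < fst u"
    by (rule obtain_max_on[of lo fst]) (use lohi gop_inj(1)[OF gop_subset[OF \<open>gop A\<close>]] in auto)
  have uA: "u \<in> A" "inbox a b c d u" "snd u < y" using u lohi assms(6) by (auto simp: lo_def)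
  have "\<exists>Qa. hung ta u (lo - {u}) Qa \<and>
    (\<forall>q\<in>Qa. snd q = snd u \<and> fst u \<le> fst q \<and> fst q < fst u \<or> inbox a (fst u) c y q)"
  proof (rule sufficient_left[OF assms(1)])
    show "snd u \<notin> snd ` (lo - {u})" by (rule gop_notin[OF \<open>gop A\<close>]) (use lohi uA in auto)
    show "gop (lo - {u})" by (rule gop_subset[OF \<open>gop A\<close>]) (use lohi in auto)
    show "\<forall>p\<in>lo - {u}. inbox a (fst u) c y p" using u(2) assms(6) lohi by (auto simp: lo_def)
  qed (use lohi u uA in auto)
  then obtain Qa where Qa: "hung ta u (lo - {u}) Qa" "\<forall>q\<in>Qa. inbox a (fst u) c y q" by fastforce
  have "\<exists>Qb. hung tb u hi Qb \<and>
    (\<forall>q\<in>Qb. fst q = fst u \<and> snd u < snd q \<and> snd q \<le> y \<or> inbox a b y d q)"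
  proof (rule sufficient_up[OF assms(2)])
    show "fst u \<notin> fst ` hi" by (rule gop_notin[OF \<open>gop A\<close>]) (use uA in \<open>auto simp: hi_def\<close>)
    show "gop hi" by (rule gop_subset[OF \<open>gop A\<close>]) (use lohi in auto)
    show "\<forall>p\<in>hi. inbox a b y d p" using assms(6) by (auto simp: hi_def)
  qed (use lohi u uA in auto)
  then obtain Qb where Qb: "hung tb u hi Qb"
    "\<forall>q\<in>Qb. fst q = fst u \<and> snd u < snd q \<and> snd q \<le> y \<or> inbox a b y d q" by blast
  show ?thesis
  proof (rule that)
    show "hung ta u A Qa" "hung tb u A Qb"
      using hung_mono[OF Qa(1)] hung_mono[OF Qb(1)] lohi by auto
    show "Qa \<inter> Qb = {}"
    proof (rule Int_emptyI)
      fix q assume "q \<in> Qa" "q \<in> Qb"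
      then show False using Qa(2)[rule_format, of q] Qb(2)[rule_format, of q] by auto
    qed
  qed (use uA Qa(2) Qb(2) y in auto)
qed

lemma corner_down:
  assumes "sufficient ta Na" "sufficient tb Nb" "finite A" "gop A" "Na + Nb + 1 \<le> card A" "\<forall>p\<in>A. inbox a b c d p"
  obtains u Qa Qb where "u \<in> A" "hung ta u A Qa" "hung tb u A Qb" "Qa \<inter> Qb = {}"
    "\<forall>q\<in>Qa. inbox a b c d q \<and> fst q < fst u" "\<forall>q\<in>Qb. inbox a b c d q \<and> snd q < snd u"
proof -
  obtain u Qa Qb where *: "u \<in> negy ` A" "hung ta u (negy ` A) Qa" "hung tb u (negy ` A) Qb" "Qa \<inter> Qb = {}"
    "\<forall>q\<in>Qa. inbox a b (-d) (-c) q \<and> fst q < fst u" "\<forall>q\<in>Qb. inbox a b (-d) (-c) q \<and> snd u < snd q"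
    by (rule corner[of ta Na tb Nb "negy ` A" a b "-d" "-c"])
       (use assms in \<open>auto simp: gop_negy card_image inj_on_subset[OF inj_invols(2)]\<close>)
  show ?thesis
  proof (rule that)
    show "hung ta (negy u) A (negy ` Qa)" "hung tb (negy u) A (negy ` Qb)"
      using hung_negy[OF *(2)] hung_negy[OF *(3)] by simp_all
    show "negy ` Qa \<inter> negy ` Qb = {}" using *(4) by (simp add: image_Int[OF inj_invols(2), symmetric])
  qed (use * in auto)
qed

text \<open>The corner keeps \<open>t2\<close> strictly left of \<open>u\<close> and
  \<open>t3\<close> strictly above \<open>u\<close>. The ray from \<open>u\<close> to the right
  therefore reaches the line \<open>x\<close> unobstructed, and beyond it \<open>t1\<close> may use
  points of any height.\<close>

lemma sufficient_Nd_above: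
  assumes "sufficient t1 N1" "sufficient t2 N2" "sufficient t3 N3"
    "finite S" "gop S" "snd w \<notin> snd ` S" "\<forall>p\<in>S. inbox a b c d p" "fst w \<le> a" "c < snd w" "snd w < d"
    "a < x" "x < b" "\<forall>p\<in>S. fst p \<noteq> x" "N1 \<le> card {p\<in>S. x < fst p}"
    "N2 + N3 + 1 \<le> card {p\<in>S. fst p < x \<and> snd w < snd p}"
  shows "\<exists>Q. hung (Nd r t1 t2 t3) w S Q \<and> (\<forall>q\<in>Q. snd q = snd w \<and> fst w < fst q \<and> fst q \<le> a \<or> inbox a b c d q)"
proof -
  define A where "A = {p\<in>S. fst p < x \<and> snd w < snd p}"
  define B where "B = {p\<in>S. x < fst p}"
  have sub: "A \<subseteq> S" "B \<subseteq> S" "finite A" "finite B" "gop A" "gop B"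
    using assms(4) gop_subset[OF assms(5)] by (auto simp: A_def B_def)
  obtain u Q2 Q3 where u: "u \<in> A" "hung t2 u A Q2" "hung t3 u A Q3" "Q2 \<inter> Q3 = {}"
    "\<forall>q\<in>Q2. inbox a x (snd w) d q \<and> fst q < fst u" "\<forall>q\<in>Q3. inbox a x (snd w) d q \<and> snd u < snd q"
    by (rule corner[OF assms(2,3) sub(3,5), of a x "snd w" d]) (use assms in \<open>auto simp: A_def\<close>)
  have uS: "u \<in> S" "a < fst u" "fst u < x" "snd w < snd u" "snd u < d" using u(1) assms(7) by (auto simp: A_def)
  have "\<exists>Q1. hung t1 u B Q1 \<and> (\<forall>q\<in>Q1. snd q = snd u \<and> fst u < fst q \<and> fst q \<le> x \<or> inbox x b c d q)"
  proof (rule sufficient_right[OF assms(1)])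
    show "snd u \<notin> snd ` B" by (rule gop_notin[OF \<open>gop S\<close>]) (use uS in \<open>auto simp: B_def\<close>)
  qed (use assms sub uS in \<open>auto simp: B_def\<close>)
  then obtain Q1 where Q1: "hung t1 u B Q1"
    "\<forall>q\<in>Q1. snd q = snd u \<and> fst u < fst q \<and> fst q \<le> x \<or> inbox x b c d q" by blast
  obtain Q where Q: "hung (Nd r t1 t2 t3) w S Q"
    "\<And>q. q \<in> Q \<Longrightarrow> q \<in> Q1 \<or> q \<in> Q2 \<or> q \<in> Q3 \<or> snd q = snd w \<and> fst w < fst q \<and> fst q \<le> fst u \<or>
       fst q = fst u \<and> min (snd w) (snd u) \<le> snd q \<and> snd q \<le> max (snd w) (snd u)"
  proof (rule hung_Nd_right[of u S w t1 Q1 t2 Q2 t3 Q3])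
    show "hung t1 u S Q1" "hung t2 u S Q2" "hung t3 u S Q3"
      using hung_mono Q1(1) u(2,3) sub by blast+
    show "Q1 \<inter> Q2 = {}"
    proof (rule Int_emptyI)
      fix q assume "q \<in> Q1" "q \<in> Q2"
      then show False using Q1(2)[rule_format, of q] u(5)[rule_format, of q] uS by auto
    qed
    show "Q1 \<inter> Q3 = {}"
    proof (rule Int_emptyI)
      fix q assume "q \<in> Q1" "q \<in> Q3"
      then show False using Q1(2)[rule_format, of q] u(6)[rule_format, of q] uS by auto
    qed
    show "\<not> (snd q = snd w \<and> fst w < fst q \<and> fst q \<le> fst u)"
      "\<not> (fst q = fst u \<and> min (snd w) (snd u) \<le> snd q \<and> snd q \<le> max (snd w) (snd u))"
      if "q \<in> Q1 \<union> Q2 \<union> Q3" for q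
      using that u(5)[rule_format, of q] u(6)[rule_format, of q] Q1(2)[rule_format, of q] uS by auto
  qed (use u uS assms(8) in auto)
  have "snd q = snd w \<and> fst w < fst q \<and> fst q \<le> a \<or> inbox a b c d q" if "q \<in> Q" for q
    using Q(2)[OF that]
  proof (elim disjE)
    assume "q \<in> Q1"
    then show ?thesis using Q1(2)[rule_format, of q] uS assms(8-12) by auto
  next
    assume "q \<in> Q2"
    then show ?thesis using u(5)[rule_format, of q] uS assms(8-12) by auto
  next
    assume "q \<in> Q3"
    then show ?thesis using u(6)[rule_format, of q] uS assms(8-12) by auto
  qed (use uS assms(8-12) in auto)
  with Q(1) show ?thesis by blast
qed

text \<open>For a node below the ray the picture is reflected. Only half of the points left of
  \<^term>\<open>x\<close> are needed, but which half is not under control: hence the factor 2.\<close>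

lemma sufficient_Nd:
  assumes "sufficient t1 N1" "sufficient t2 N2" "sufficient t3 N3"
  shows "sufficient (Nd r t1 t2 t3) (N1 + 2 * N2 + 2 * N3 + 1)"
  unfolding sufficient_def
proof (intro allI impI, elim conjE)
  fix w :: point and S a b c d
  assume S: "finite S" "gop S" "snd w \<notin> snd ` S" "N1 + 2 * N2 + 2 * N3 + 1 \<le> card S"
    "\<forall>p\<in>S. inbox a b c d p" and w: "fst w \<le> a" "c < snd w" "snd w < d"
  have "S \<noteq> {}" using S(4) by auto
  then have "a < b" using S(5) by fastforce
  obtain x where x: "a < x" "x < b" "\<forall>p\<in>S. fst p \<noteq> x" "card {p\<in>S. fst p < x} = 2 * N2 + 2 * N3 + 1"
    "card {p\<in>S. x < fst p} = card S - (2 * N2 + 2 * N3 + 1)"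
    by (rule separate[of S fst a b "2 * N2 + 2 * N3 + 1"]) (use S \<open>a < b\<close> gop_inj in auto)
  let ?U = "{p\<in>S. fst p < x \<and> snd w < snd p}" and ?D = "{p\<in>S. fst p < x \<and> snd p < snd w}"
  have "{p\<in>S. fst p < x} = ?U \<union> ?D" using S(3) by (auto simp: image_iff neq_iff)
  then have "card ?U + card ?D \<ge> 2 * N2 + 2 * N3 + 1" using x(4) card_Un_le[of ?U ?D] by simp
  then consider "N2 + N3 + 1 \<le> card ?U" | "N2 + N3 + 1 \<le> card ?D" by linarith
  then show "\<exists>Q. hung (Nd r t1 t2 t3) w S Q \<and> (\<forall>q\<in>Q. snd q = snd w \<and> fst w < fst q \<and> fst q \<le> a \<or> inbox a b c d q)"
  proof cases
    case 1
    then show ?thesis using sufficient_Nd_above[OF assms S(1,2,3,5) w x(1,2,3)] x(5) S(4) by simp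
  next
    case 2
    have im: "{p \<in> negy ` S. fst p < x \<and> snd (negy w) < snd p} = negy ` ?D"
      "{p \<in> negy ` S. x < fst p} = negy ` {p\<in>S. x < fst p}" by auto
    have ny: "snd (negy w) \<notin> snd ` negy ` S"
      using S(3) by (auto simp: image_iff)
    have "\<exists>Q. hung (Nd r t1 t2 t3) (negy w) (negy ` S) Q \<and>
      (\<forall>q\<in>Q. snd q = snd (negy w) \<and> fst (negy w) < fst q \<and> fst q \<le> a \<or> inbox a b (-d) (-c) q)"
      by (rule sufficient_Nd_above[OF assms, where x = x])
         (use S w x 2 ny in \<open>simp_all add: gop_negy im card_image inj_on_subset[OF inj_invols(2)] del: fst_snd_negs\<close>,
           simp_all)
    then obtain Q where Q: "hung (Nd r t1 t2 t3) (negy w) (negy ` S) Q"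
      "\<forall>q\<in>Q. snd q = snd (negy w) \<and> fst (negy w) < fst q \<and> fst q \<le> a \<or> inbox a b (-d) (-c) q" by blast
    have "hung (Nd r t1 t2 t3) w S (negy ` Q)" using hung_negy[OF Q(1)] by simp
    with Q(2) show ?thesis by (intro exI[of _ "negy ` Q"]) auto
  qed
qed

subsection \<open>Using the points on both sides of the ray\<close>

text \<open>The ray of \<^term>\<open>w\<close> runs to the right at a height above \<^term>\<open>l\<close>. A heavy path of the tree is
  drawn on \<^term>\<open>A\<close>, above \<^term>\<open>l\<close>, up to some vertex placed in \<^term>\<open>Z\<close>; from there one of the
  subtrees reaches back, below \<^term>\<open>l\<close>, to the otherwise wasted points \<^term>\<open>D\<close>.\<close>

definition sufficient_back :: "'a tr \<Rightarrow> nat \<Rightarrow> nat \<Rightarrow> nat \<Rightarrow> bool" where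
  "sufficient_back t e m z \<longleftrightarrow> (\<forall>w A D Z a b c d l x2 x3.
     finite (A \<union> D \<union> Z) \<and> gop (A \<union> D \<union> Z) \<and> snd w \<notin> snd ` (A \<union> D \<union> Z) \<and> l \<notin> snd ` Z \<and>
     e \<le> card D \<and> m \<le> card A \<and> z \<le> card Z \<and>
     (\<forall>p\<in>A. inbox x2 x3 l d p) \<and> (\<forall>p\<in>D. inbox a x3 c l p) \<and> (\<forall>p\<in>Z. inbox x3 b c d p) \<and>
     a < fst w \<and> fst w \<le> x2 \<and> x2 \<le> x3 \<and> x3 < b \<and> c < l \<and> l < snd w \<and> snd w < d \<longrightarrow>
     (\<exists>Q. hung t w (A \<union> D \<union> Z) Q \<and>
       (\<forall>q\<in>Q. inbox a b c d q \<and> (snd q < l \<or> x2 < fst q \<or> snd q = snd w \<and> fst w < fst q))))"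

lemma sufficient_backE:
  assumes "sufficient_back t e m z"
    "finite (A \<union> D \<union> Z)" "gop (A \<union> D \<union> Z)" "snd w \<notin> snd ` (A \<union> D \<union> Z)" "l \<notin> snd ` Z"
    "e \<le> card D" "m \<le> card A" "z \<le> card Z"
    "\<forall>p\<in>A. inbox x2 x3 l d p" "\<forall>p\<in>D. inbox a x3 c l p" "\<forall>p\<in>Z. inbox x3 b c d p"
    "a < fst w" "fst w \<le> x2" "x2 \<le> x3" "x3 < b" "c < l" "l < snd w" "snd w < d"
  obtains Q where "hung t w (A \<union> D \<union> Z) Q"
    "\<And>q. q \<in> Q \<Longrightarrow> inbox a b c d q \<and> (snd q < l \<or> x2 < fst q \<or> snd q = snd w \<and> fst w < fst q)"
  using assms(1)[unfolded sufficient_back_def, rule_format, of A D Z w l x2 x3 d a c b] assms(2-) by blast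

lemma card_inter_split: "finite A \<Longrightarrow> card A = card {p\<in>A. P p} + card {p\<in>A. \<not> P p}"
  by (subst card_Un_disjoint[symmetric]) (auto intro: arg_cong[of _ _ card])

lemma obtain_min_on:
  fixes f :: "'b \<Rightarrow> real"
  assumes "finite S" "S \<noteq> {}" "inj_on f S"
  obtains u where "u \<in> S" "\<And>p. p \<in> S \<Longrightarrow> p \<noteq> u \<Longrightarrow> f u < f p"
proof -
  have "inj_on (\<lambda>p. - f p) S" using assms(3) by (simp add: inj_on_def)
  from obtain_max_on[OF assms(1,2) this] show ?thesis using that by (metis neg_less_iff_less)
qed

text \<open>The heights \<open>l\<close> and \<open>snd w\<close> cut \<open>Y\<close> into three
  bands. Since \<open>N2 + 3 * N3 + 1\<close> exceeds \<open>N3 + N3 + (N2 + N3)\<close>, some band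
  has a point to spare for \<open>u\<close>. From the two lower bands \<open>t2\<close> reaches
  \<open>D\<close>, so only \<open>t3\<close> is paid for; above the ray the edge from
  \<open>w\<close> is in the way and both are paid for. The ray from \<open>u\<close> to the right
  always stays free.\<close>

lemma sufficient_back_split_vertex:
  assumes G: "sufficient t2 N2" "sufficient t3 N3"
    and fin: "finite D" "finite Y" and gop: "gop (D \<union> Y)" and w: "snd w \<notin> snd ` Y" "l \<notin> snd ` Y"
    and card: "N2 \<le> card D" "N2 + 3 * N3 + 1 \<le> card Y"
    and box: "\<forall>p\<in>D. inbox a x3 c l p" "\<forall>p\<in>Y. inbox x3 x4 c d p"
    and ord: "a < fst w" "fst w \<le> x2" "x2 \<le> x3" "x3 < x4" "c < l" "l < snd w" "snd w < d"
  obtains u Q2 Q3 where "u \<in> Y" "hung t2 u (D \<union> Y) Q2" "hung t3 u (D \<union> Y) Q3" "Q2 \<inter> Q3 = {}"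
    "\<And>q. q \<in> Q2 \<union> Q3 \<Longrightarrow> inbox a x4 c d q \<and> (snd q < l \<or> x2 < fst q) \<and>
       \<not> (snd q = snd u \<and> fst u < fst q) \<and> \<not> (snd q = snd w \<and> fst w < fst q \<and> fst q \<le> fst u) \<and>
       \<not> (fst q = fst u \<and> min (snd w) (snd u) \<le> snd q \<and> snd q \<le> max (snd w) (snd u))"
proof -
  define Y1 where "Y1 = {p\<in>Y. snd p < l}"
  define Y2 where "Y2 = {p\<in>Y. l < snd p \<and> snd p < snd w}"
  define Y3 where "Y3 = {p\<in>Y. snd w < snd p}"
  have sub: "Y1 \<subseteq> Y" "Y2 \<subseteq> Y" "Y3 \<subseteq> Y" and finY: "finite Y1" "finite Y2" "finite Y3"
    using fin by (auto simp: Y1_def Y2_def Y3_def)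
  have gops: "gop Y1" "gop Y2" "gop Y3" "gop D" "gop Y" using gop_subset[OF gop] sub by blast+
  have "Y = Y1 \<union> Y2 \<union> Y3" using w ord by (auto simp: Y1_def Y2_def Y3_def image_iff neq_iff)
  then have "card Y \<le> card Y1 + card Y2 + card Y3"
    using card_Un_le[of "Y1 \<union> Y2" Y3] card_Un_le[of Y1 Y2] by simp
  then consider "N3 + 1 \<le> card Y1" | "N3 + 1 \<le> card Y2" | "N2 + N3 + 1 \<le> card Y3"
    using card by linarith
  then show ?thesis
  proof cases
    case 1
    then have "Y1 \<noteq> {}" by auto
    \<comment> \<open>The topmost point of the lowest band: the edge from \<open>w\<close> drops
      onto it, \<open>t3\<close> hangs down, and \<open>t2\<close> leaves to the left towards
      \<open>D\<close>.\<close>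
    obtain u where u: "u \<in> Y1" "\<And>p. p \<in> Y1 \<Longrightarrow> p \<noteq> u \<Longrightarrow> snd p < snd u"
      using obtain_max_on[OF finY(1) \<open>Y1 \<noteq> {}\<close> gop_inj(2)[OF gops(1)]] by blast
    have uY: "u \<in> Y" "x3 < fst u" "fst u < x4" "c < snd u" "snd u < l"
      using u(1) box by (auto simp: Y1_def)
    have "\<exists>Q. hung t3 u (Y1 - {u}) Q \<and>
      (\<forall>q\<in>Q. fst q = fst u \<and> snd u \<le> snd q \<and> snd q < snd u \<or> inbox x3 x4 c (snd u) q)"
    proof (rule sufficient_down[OF G(2)])
      show "gop (Y1 - {u})" by (rule gop_subset[OF gops(1)]) auto
      show "fst u \<notin> fst ` (Y1 - {u})" by (rule gop_notin(1)[OF gops(1)]) (use u in auto)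
      show "N3 \<le> card (Y1 - {u})" using 1 u(1) finY(1) by simp
      show "\<forall>p\<in>Y1 - {u}. inbox x3 x4 c (snd u) p" using u(2) box(2) sub by auto
    qed (use finY uY(2-) in \<open>simp_all\<close>)
    then obtain Q3 where Q3: "hung t3 u (Y1 - {u}) Q3" "\<forall>q\<in>Q3. inbox x3 x4 c (snd u) q" by fastforce
    have "\<exists>Q. hung t2 u D Q \<and>
      (\<forall>q\<in>Q. snd q = snd u \<and> x3 \<le> fst q \<and> fst q < fst u \<or> inbox a x3 c l q)"
    proof (rule sufficient_left[OF G(1)])
      have "u \<notin> D" using box(1) uY(2) by fastforce
      then show "snd u \<notin> snd ` D" by (intro gop_notin(2)[OF gop]) (use uY in auto)
    qed (use fin(1) gops(4) card(1) box(1) uY(2-) in \<open>simp_all\<close>)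
    then obtain Q2 where Q2: "hung t2 u D Q2"
      "\<forall>q\<in>Q2. snd q = snd u \<and> x3 \<le> fst q \<and> fst q < fst u \<or> inbox a x3 c l q" by blast
    show ?thesis
    proof (rule that[of u Q2 Q3])
      show "hung t2 u (D \<union> Y) Q2" "hung t3 u (D \<union> Y) Q3"
        by (rule hung_mono[OF Q2(1)] hung_mono[OF Q3(1)]; use sub in blast)+
      show "Q2 \<inter> Q3 = {}"
      proof (rule Int_emptyI)
        fix q assume "q \<in> Q2" "q \<in> Q3"
        then show False using Q2(2)[rule_format, of q] Q3(2)[rule_format, of q] by auto
      qed
      fix q assume "q \<in> Q2 \<union> Q3"
      then show "inbox a x4 c d q \<and> (snd q < l \<or> x2 < fst q) \<and>
       \<not> (snd q = snd u \<and> fst u < fst q) \<and> \<not> (snd q = snd w \<and> fst w < fst q \<and> fst q \<le> fst u) \<and>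
       \<not> (fst q = fst u \<and> min (snd w) (snd u) \<le> snd q \<and> snd q \<le> max (snd w) (snd u))"
        using Q2(2)[rule_format, of q] Q3(2)[rule_format, of q] uY ord by auto
    qed (use uY in auto)
  next
    case 2
    then have "Y2 \<noteq> {}" by auto
    \<comment> \<open>The rightmost point of the middle band: \<open>t3\<close> stays in the band,
      to the left, and \<open>t2\<close> drops from \<open>u\<close> through the height
      \<open>l\<close>.\<close>
    obtain u where u: "u \<in> Y2" "\<And>p. p \<in> Y2 \<Longrightarrow> p \<noteq> u \<Longrightarrow> fst p < fst u"
      using obtain_max_on[OF finY(2) \<open>Y2 \<noteq> {}\<close> gop_inj(1)[OF gops(2)]] by blast
    have uY: "u \<in> Y" "x3 < fst u" "fst u < x4" "l < snd u" "snd u < snd w"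
      using u(1) box by (auto simp: Y2_def)
    have "\<exists>Q. hung t3 u (Y2 - {u}) Q \<and>
      (\<forall>q\<in>Q. snd q = snd u \<and> fst u \<le> fst q \<and> fst q < fst u \<or> inbox x3 (fst u) l (snd w) q)"
    proof (rule sufficient_left[OF G(2)])
      show "gop (Y2 - {u})" by (rule gop_subset[OF gops(2)]) auto
      show "snd u \<notin> snd ` (Y2 - {u})" by (rule gop_notin(2)[OF gops(2)]) (use u in auto)
      show "N3 \<le> card (Y2 - {u})" using 2 u(1) finY(2) by simp
      show "\<forall>p\<in>Y2 - {u}. inbox x3 (fst u) l (snd w) p" using u(2) box(2) by (auto simp: Y2_def)
    qed (use finY uY(2-) in \<open>simp_all\<close>)
    then obtain Q3 where Q3: "hung t3 u (Y2 - {u}) Q3" "\<forall>q\<in>Q3. inbox x3 (fst u) l (snd w) q" by fastforce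
    have "\<exists>Q. hung t2 u D Q \<and>
      (\<forall>q\<in>Q. fst q = fst u \<and> l \<le> snd q \<and> snd q < snd u \<or> inbox a x4 c l q)"
    proof (rule sufficient_down[OF G(1)])
      have "u \<notin> D" using box(1) uY(2) by fastforce
      then show "fst u \<notin> fst ` D" by (intro gop_notin(1)[OF gop]) (use uY in auto)
      show "\<forall>p\<in>D. inbox a x4 c l p" using box(1) ord(4) by fastforce
    qed (use fin(1) gops(4) card(1) uY(2-) ord in \<open>simp_all\<close>)
    then obtain Q2 where Q2: "hung t2 u D Q2"
      "\<forall>q\<in>Q2. fst q = fst u \<and> l \<le> snd q \<and> snd q < snd u \<or> inbox a x4 c l q" by meson
    show ?thesis
    proof (rule that[of u Q2 Q3])
      show "hung t2 u (D \<union> Y) Q2" "hung t3 u (D \<union> Y) Q3"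
        by (rule hung_mono[OF Q2(1)] hung_mono[OF Q3(1)]; use sub in blast)+
      show "Q2 \<inter> Q3 = {}"
      proof (rule Int_emptyI)
        fix q assume "q \<in> Q2" "q \<in> Q3"
        then show False using Q2(2)[rule_format, of q] Q3(2)[rule_format, of q] by auto
      qed
      fix q assume "q \<in> Q2 \<union> Q3"
      then show "inbox a x4 c d q \<and> (snd q < l \<or> x2 < fst q) \<and>
       \<not> (snd q = snd u \<and> fst u < fst q) \<and> \<not> (snd q = snd w \<and> fst w < fst q \<and> fst q \<le> fst u) \<and>
       \<not> (fst q = fst u \<and> min (snd w) (snd u) \<le> snd q \<and> snd q \<le> max (snd w) (snd u))"
        using Q2(2)[rule_format, of q] Q3(2)[rule_format, of q] uY ord by auto
    qed (use uY in auto)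
  next
    case 3
    obtain u Q2 Q3 where u: "u \<in> Y3" "hung t2 u Y3 Q2" "hung t3 u Y3 Q3" "Q2 \<inter> Q3 = {}"
      "\<forall>q\<in>Q2. inbox x3 x4 (snd w) d q \<and> fst q < fst u" "\<forall>q\<in>Q3. inbox x3 x4 (snd w) d q \<and> snd u < snd q"
      by (rule corner[OF G finY(3) gops(3) 3, of x3 x4 "snd w" d]) (use box in \<open>auto simp: Y3_def\<close>)
    have uY: "u \<in> Y" "x3 < fst u" "fst u < x4" "snd w < snd u"
      using u(1) box by (auto simp: Y3_def)
    show ?thesis
    proof (rule that[of u Q2 Q3])
      show "hung t2 u (D \<union> Y) Q2" "hung t3 u (D \<union> Y) Q3"
        by (rule hung_mono[OF u(2)] hung_mono[OF u(3)]; use sub in blast)+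
      fix q assume "q \<in> Q2 \<union> Q3"
      then show "inbox a x4 c d q \<and> (snd q < l \<or> x2 < fst q) \<and>
       \<not> (snd q = snd u \<and> fst u < fst q) \<and> \<not> (snd q = snd w \<and> fst w < fst q \<and> fst q \<le> fst u) \<and>
       \<not> (fst q = fst u \<and> min (snd w) (snd u) \<le> snd q \<and> snd q \<le> max (snd w) (snd u))"
        using u(5)[rule_format, of q] u(6)[rule_format, of q] uY ord by auto
    qed (use uY u in auto)
  qed
qed

text \<open>The path ends here, so \<open>m = 0\<close>, and \<open>e = N2\<close> because one large
  subtree goes to \<open>D\<close>. Still \<open>z\<close> includes \<open>N2\<close>: if the vertex
  lands above the ray, \<open>t2\<close> has to be drawn inside \<open>Z\<close>. The points of
  \<open>Z\<close> right of \<open>x4\<close> serve \<open>t1\<close>.\<close>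

lemma sufficient_back_split:
  assumes "sufficient t1 N1" "sufficient t2 N2" "sufficient t3 N3"
  shows "sufficient_back (Nd r t1 t2 t3) N2 0 (N1 + N2 + 3 * N3 + 1)"
  unfolding sufficient_back_def
proof (intro allI impI, elim conjE)
  fix w :: point and A D Z a b c d l x2 x3
  assume fin: "finite (A \<union> D \<union> Z)" and gop: "gop (A \<union> D \<union> Z)"
    and w: "snd w \<notin> snd ` (A \<union> D \<union> Z)" "l \<notin> snd ` Z"
    and card: "N2 \<le> card D" "N1 + N2 + 3 * N3 + 1 \<le> card Z"
    and box: "\<forall>p\<in>A. inbox x2 x3 l d p" "\<forall>p\<in>D. inbox a x3 c l p" "\<forall>p\<in>Z. inbox x3 b c d p"
    and ord: "a < fst w" "fst w \<le> x2" "x2 \<le> x3" "x3 < b" "c < l" "l < snd w" "snd w < d"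
  have gopZ: "gop Z" by (rule gop_subset[OF gop]) auto
  obtain x4 where x4: "x3 < x4" "x4 < b" "\<forall>p\<in>Z. fst p \<noteq> x4" "card {p\<in>Z. fst p < x4} = N2 + 3 * N3 + 1"
    "card {p\<in>Z. x4 < fst p} = card Z - (N2 + 3 * N3 + 1)"
    by (rule separate[of Z fst x3 b "N2 + 3 * N3 + 1"]) (use fin gop_inj(1)[OF gopZ] ord box card in auto)
  define Y where "Y = {p\<in>Z. fst p < x4}"
  define B where "B = {p\<in>Z. x4 < fst p}"
  have sub: "Y \<subseteq> Z" "B \<subseteq> Z" "finite D" "finite Y" "finite B" using fin by (auto simp: Y_def B_def)
  have gops: "gop (D \<union> Y)" "gop B" by (rule gop_subset[OF gop]; use sub in blast)+
  obtain u Q2 Q3 where u: "u \<in> Y" "hung t2 u (D \<union> Y) Q2" "hung t3 u (D \<union> Y) Q3" "Q2 \<inter> Q3 = {}"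
    "\<And>q. q \<in> Q2 \<union> Q3 \<Longrightarrow> inbox a x4 c d q \<and> (snd q < l \<or> x2 < fst q) \<and>
       \<not> (snd q = snd u \<and> fst u < fst q) \<and> \<not> (snd q = snd w \<and> fst w < fst q \<and> fst q \<le> fst u) \<and>
       \<not> (fst q = fst u \<and> min (snd w) (snd u) \<le> snd q \<and> snd q \<le> max (snd w) (snd u))"
  proof (rule sufficient_back_split_vertex[OF assms(2,3) sub(3,4) gops(1), of w l a x3 c x4 d x2])
    show "N2 + 3 * N3 + 1 \<le> card Y" using x4 by (simp add: Y_def)
  qed (use w box card ord x4 in \<open>auto simp: Y_def\<close>)
  have uY: "u \<in> Z" "x3 < fst u" "fst u < x4" "c < snd u" "snd u < d" using u(1) box by (auto simp: Y_def)
  have "\<exists>Q1. hung t1 u B Q1 \<and> (\<forall>q\<in>Q1. snd q = snd u \<and> fst u < fst q \<and> fst q \<le> x4 \<or> inbox x4 b c d q)"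
  proof (rule sufficient_right[OF assms(1)])
    show "snd u \<notin> snd ` B" by (rule gop_notin(2)[OF gopZ]) (use uY in \<open>auto simp: B_def\<close>)
    show "N1 \<le> card B" using x4 card by (simp add: B_def)
  qed (use sub gops box uY in \<open>auto simp: B_def\<close>)
  then obtain Q1 where Q1: "hung t1 u B Q1"
    "\<forall>q\<in>Q1. snd q = snd u \<and> fst u < fst q \<and> fst q \<le> x4 \<or> inbox x4 b c d q" by blast
  let ?S = "A \<union> D \<union> Z"
  obtain Q where Q: "hung (Nd r t1 t2 t3) w ?S Q"
    "\<And>q. q \<in> Q \<Longrightarrow> q \<in> Q1 \<or> q \<in> Q2 \<or> q \<in> Q3 \<or> snd q = snd w \<and> fst w < fst q \<and> fst q \<le> fst u \<or>
       fst q = fst u \<and> min (snd w) (snd u) \<le> snd q \<and> snd q \<le> max (snd w) (snd u)"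
  proof (rule hung_Nd_right[of u ?S w t1 Q1 t2 Q2 t3 Q3])
    show "hung t1 u ?S Q1" "hung t2 u ?S Q2" "hung t3 u ?S Q3"
      by (rule hung_mono[OF Q1(1)] hung_mono[OF u(2)] hung_mono[OF u(3)]; use sub in blast)+
    show "Q1 \<inter> Q2 = {}"
    proof (rule Int_emptyI)
      fix q assume "q \<in> Q1" "q \<in> Q2"
      then show False using Q1(2)[rule_format, of q] u(5)[of q] uY by auto
    qed
    show "Q1 \<inter> Q3 = {}"
    proof (rule Int_emptyI)
      fix q assume "q \<in> Q1" "q \<in> Q3"
      then show False using Q1(2)[rule_format, of q] u(5)[of q] uY by auto
    qed
    fix q assume "q \<in> Q1 \<union> Q2 \<union> Q3"
    then show "\<not> (snd q = snd w \<and> fst w < fst q \<and> fst q \<le> fst u)"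
      "\<not> (fst q = fst u \<and> min (snd w) (snd u) \<le> snd q \<and> snd q \<le> max (snd w) (snd u))"
      using u(5)[of q] Q1(2)[rule_format, of q] uY by auto
  qed (use u uY ord in auto)
  have "inbox a b c d q \<and> (snd q < l \<or> x2 < fst q \<or> snd q = snd w \<and> fst w < fst q)" if "q \<in> Q" for q
    using Q(2)[OF that]
  proof (elim disjE)
    assume "q \<in> Q1"
    then show ?thesis using Q1(2)[rule_format, of q] uY ord x4(1,2) by auto
  next
    assume "q \<in> Q2"
    then show ?thesis using u(5)[of q] x4 by auto
  next
    assume "q \<in> Q3"
    then show ?thesis using u(5)[of q] x4 by auto
  qed (use uY ord x4 in auto)
  with Q(1) show "\<exists>Q. hung (Nd r t1 t2 t3) w ?S Q \<and>
       (\<forall>q\<in>Q. inbox a b c d q \<and> (snd q < l \<or> x2 < fst q \<or> snd q = snd w \<and> fst w < fst q))" by blast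
qed

text \<open>The root and the light subtrees \<open>t2\<close>, \<open>t3\<close> form a corner on
  the leftmost points of \<open>A\<close>, above or below the ray of \<open>w\<close>; not knowing
  the side costs the factor 2 again. The corner stays above \<open>l\<close> and left of
  \<open>x\<close>, so the way back below \<open>l\<close> remains open, and the same
  \<open>D\<close>, \<open>Z\<close> and \<open>l\<close> serve the heavy child, whose ray starts at
  the new vertex.\<close>

lemma sufficient_back_path:
  assumes K: "sufficient_back t1 e m z" and G: "sufficient t2 N2" "sufficient t3 N3"
  shows "sufficient_back (Nd r t1 t2 t3) e (m + 2 * N2 + 2 * N3 + 1) z"
  unfolding sufficient_back_def
proof (intro allI impI, elim conjE)
  fix w :: point and A D Z a b c d l x2 x3
  assume fin: "finite (A \<union> D \<union> Z)" and gop: "gop (A \<union> D \<union> Z)"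
    and w: "snd w \<notin> snd ` (A \<union> D \<union> Z)" "l \<notin> snd ` Z"
    and card: "e \<le> card D" "m + 2 * N2 + 2 * N3 + 1 \<le> card A" "z \<le> card Z"
    and box: "\<forall>p\<in>A. inbox x2 x3 l d p" "\<forall>p\<in>D. inbox a x3 c l p" "\<forall>p\<in>Z. inbox x3 b c d p"
    and ord: "a < fst w" "fst w \<le> x2" "x2 \<le> x3" "x3 < b" "c < l" "l < snd w" "snd w < d"
  have gopA: "gop A" by (rule gop_subset[OF gop]) auto
  have "A \<noteq> {}" using card(2) by auto
  then have "x2 < x3" using box(1) by fastforce
  obtain x where x: "x2 < x" "x < x3" "\<forall>p\<in>A. fst p \<noteq> x" "card {p\<in>A. fst p < x} = 2 * N2 + 2 * N3 + 1"
    "card {p\<in>A. x < fst p} = card A - (2 * N2 + 2 * N3 + 1)"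
    by (rule separate[of A fst x2 x3 "2 * N2 + 2 * N3 + 1"])
       (use fin gop_inj(1)[OF gopA] \<open>x2 < x3\<close> box(1) card(2) in auto)
  define B where "B = {p\<in>A. x < fst p}"
  define U where "U = {p\<in>A. fst p < x \<and> snd w < snd p}"
  define V where "V = {p\<in>A. fst p < x \<and> snd p < snd w}"
  let ?S = "A \<union> D \<union> Z"
  have sub: "B \<subseteq> A" "U \<subseteq> A" "V \<subseteq> A" "finite B" "finite U" "finite V"
    using fin by (auto simp: B_def U_def V_def)
  have gops: "gop U" "gop V" "gop (B \<union> D \<union> Z)" by (rule gop_subset[OF gop]; use sub in blast)+
  have "{p\<in>A. fst p < x} = U \<union> V" using w(1) by (auto simp: U_def V_def image_iff neq_iff)
  then have "2 * N2 + 2 * N3 + 1 \<le> card U + card V" using x(4) card_Un_le[of U V] by simp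
  then consider "N2 + N3 + 1 \<le> card U" | "N2 + N3 + 1 \<le> card V" by linarith
  then obtain u Q2 Q3 where u: "u \<in> A" "fst u < x" "hung t2 u A Q2" "hung t3 u A Q3" "Q2 \<inter> Q3 = {}"
    and reg: "\<And>q. q \<in> Q2 \<union> Q3 \<Longrightarrow> inbox x2 x l d q \<and> snd q \<noteq> snd w \<and>
       \<not> (snd q = snd u \<and> fst u < fst q) \<and>
       \<not> (fst q = fst u \<and> min (snd w) (snd u) \<le> snd q \<and> snd q \<le> max (snd w) (snd u))"
  proof cases
    case 1
    obtain u Q2 Q3 where *: "u \<in> U" "hung t2 u U Q2" "hung t3 u U Q3" "Q2 \<inter> Q3 = {}"
      "\<forall>q\<in>Q2. inbox x2 x (snd w) d q \<and> fst q < fst u" "\<forall>q\<in>Q3. inbox x2 x (snd w) d q \<and> snd u < snd q"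
      by (rule corner[OF G sub(5) gops(1) 1, of x2 x "snd w" d]) (use box in \<open>auto simp: U_def\<close>)
    have uA: "u \<in> A" "fst u < x" "snd w < snd u" using *(1) by (auto simp: U_def)
    show ?thesis
    proof (rule that)
      show "hung t2 u A Q2" "hung t3 u A Q3" by (rule hung_mono[OF *(2)] hung_mono[OF *(3)]; use sub in blast)+
      show "inbox x2 x l d q \<and> snd q \<noteq> snd w \<and>
       \<not> (snd q = snd u \<and> fst u < fst q) \<and>
       \<not> (fst q = fst u \<and> min (snd w) (snd u) \<le> snd q \<and> snd q \<le> max (snd w) (snd u))"
        if "q \<in> Q2 \<union> Q3" for q
        using that *(5)[rule_format, of q] *(6)[rule_format, of q] uA ord by auto
    qed (use uA *(4) in auto)
  next
    case 2
    obtain u Q2 Q3 where *: "u \<in> V" "hung t2 u V Q2" "hung t3 u V Q3" "Q2 \<inter> Q3 = {}"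
      "\<forall>q\<in>Q2. inbox x2 x l (snd w) q \<and> fst q < fst u" "\<forall>q\<in>Q3. inbox x2 x l (snd w) q \<and> snd q < snd u"
      by (rule corner_down[OF G sub(6) gops(2) 2, of x2 x l "snd w"]) (use box in \<open>auto simp: V_def\<close>)
    have uA: "u \<in> A" "fst u < x" "snd u < snd w" using *(1) by (auto simp: V_def)
    show ?thesis
    proof (rule that)
      show "hung t2 u A Q2" "hung t3 u A Q3" by (rule hung_mono[OF *(2)] hung_mono[OF *(3)]; use sub in blast)+
      show "inbox x2 x l d q \<and> snd q \<noteq> snd w \<and>
       \<not> (snd q = snd u \<and> fst u < fst q) \<and>
       \<not> (fst q = fst u \<and> min (snd w) (snd u) \<le> snd q \<and> snd q \<le> max (snd w) (snd u))"
        if "q \<in> Q2 \<union> Q3" for q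
        using that *(5)[rule_format, of q] *(6)[rule_format, of q] uA ord by auto
    qed (use uA *(4) in auto)
  qed
  have uA: "x2 < fst u" "l < snd u" "snd u < d" using u(1) box by auto
  obtain Q1 where Q1: "hung t1 u (B \<union> D \<union> Z) Q1"
    "\<And>q. q \<in> Q1 \<Longrightarrow> inbox a b c d q \<and> (snd q < l \<or> x < fst q \<or> snd q = snd u \<and> fst u < fst q)"
  proof (rule sufficient_backE[OF K, of B D Z u l x x3 d a c b])
    have "u \<notin> D" "u \<notin> Z" using box u(2) uA x(2) by fastforce+
    then show "snd u \<notin> snd ` (B \<union> D \<union> Z)"
      by (intro gop_notin(2)[OF gop]) (use u sub in \<open>auto simp: B_def\<close>)
    show "m \<le> card B" using x(5) card by (simp add: B_def)
  qed (use fin sub gops w box card x ord uA u(2) in \<open>auto simp: B_def\<close>)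
  obtain Q where Q: "hung (Nd r t1 t2 t3) w ?S Q"
    "\<And>q. q \<in> Q \<Longrightarrow> q \<in> Q1 \<or> q \<in> Q2 \<or> q \<in> Q3 \<or> snd q = snd w \<and> fst w < fst q \<and> fst q \<le> fst u \<or>
       fst q = fst u \<and> min (snd w) (snd u) \<le> snd q \<and> snd q \<le> max (snd w) (snd u)"
  proof (rule hung_Nd_right[of u ?S w t1 Q1 t2 Q2 t3 Q3])
    show "hung t1 u ?S Q1" "hung t2 u ?S Q2" "hung t3 u ?S Q3"
      by (rule hung_mono[OF Q1(1)] hung_mono[OF u(3)] hung_mono[OF u(4)]; use sub in blast)+
    show "Q1 \<inter> Q2 = {}"
    proof (rule Int_emptyI)
      fix q assume "q \<in> Q1" "q \<in> Q2"
      then show False using Q1(2)[of q] reg[of q] by auto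
    qed
    show "Q1 \<inter> Q3 = {}"
    proof (rule Int_emptyI)
      fix q assume "q \<in> Q1" "q \<in> Q3"
      then show False using Q1(2)[of q] reg[of q] by auto
    qed
    have "snd w \<noteq> snd u" using w(1) u(1) by (auto simp: image_iff)
    fix q assume "q \<in> Q1 \<union> Q2 \<union> Q3"
    then show "\<not> (snd q = snd w \<and> fst w < fst q \<and> fst q \<le> fst u)"
      "\<not> (fst q = fst u \<and> min (snd w) (snd u) \<le> snd q \<and> snd q \<le> max (snd w) (snd u))"
      using reg[of q] Q1(2)[of q] u(2) uA ord \<open>snd w \<noteq> snd u\<close> by (auto simp: min_def max_def split: if_splits)
  qed (use u uA ord in auto)
  have "inbox a b c d q \<and> (snd q < l \<or> x2 < fst q \<or> snd q = snd w \<and> fst w < fst q)" if "q \<in> Q" for q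
    using Q(2)[OF that]
  proof (elim disjE)
    assume "q \<in> Q1"
    then show ?thesis using Q1(2)[of q] uA ord x(1) by auto
  next
    assume "q \<in> Q2"
    then show ?thesis using reg[of q] x ord by auto
  next
    assume "q \<in> Q3"
    then show ?thesis using reg[of q] x ord by auto
  qed (use uA u(2) ord x in \<open>auto simp: min_def max_def split: if_splits\<close>)
  with Q(1) show "\<exists>Q. hung (Nd r t1 t2 t3) w ?S Q \<and>
       (\<forall>q\<in>Q. inbox a b c d q \<and> (snd q < l \<or> x2 < fst q \<or> snd q = snd w \<and> fst w < fst q))" by blast
qed

section \<open>Nodes with two large subtrees\<close>

text \<open>From the lowest point \<open>u\<close> of \<open>A2\<close> the subtree
  \<open>t1\<close> goes left and \<open>t3\<close> up, while the edge from \<open>w\<close> arrives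
  from below. The three alternatives in \<open>T2\<close> (below the ray of \<open>w\<close>, right
  of \<open>x2\<close>, on the ray of \<open>u\<close>) describe a region that avoids all of these,
  so it is left open whether \<open>t2\<close> goes right or also reaches back.\<close>

lemma hung_Nd_up:
  assumes G: "sufficient t1 N1" "sufficient t3 N3"
    and fin: "finite (A1 \<union> A2)" and gop: "gop (A1 \<union> A2)"
    and card: "N1 \<le> card A1" "N3 + 1 \<le> card A2"
    and box: "\<forall>p\<in>A1. inbox a x1 l d p" "\<forall>p\<in>A2. inbox x1 x2 l d p"
    and ord: "fst w \<le> a" "snd w = l" "a < x1" "x1 < x2" "x2 < b" "c < l" "l < d"
    and sub: "A1 \<union> A2 \<union> P \<subseteq> S"
    and T2: "\<And>u. u \<in> A2 \<Longrightarrow> \<exists>Q. hung t2 u P Q \<and>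
      (\<forall>q\<in>Q. inbox a b c d q \<and> (snd q < l \<or> x2 < fst q \<or> snd q = snd u \<and> fst u < fst q))"
  shows "\<exists>Q. hung (Nd r t1 t2 t3) w S Q \<and> (\<forall>q\<in>Q. snd q = snd w \<and> fst w < fst q \<and> fst q \<le> a \<or> inbox a b c d q)"
proof -
  have gops: "gop A1" "gop A2" by (rule gop_subset[OF gop]; blast)+
  have fins: "finite A1" "finite A2" using fin by auto
  have "A2 \<noteq> {}" using card(2) by auto
  obtain u where u: "u \<in> A2" "\<And>p. p \<in> A2 \<Longrightarrow> p \<noteq> u \<Longrightarrow> snd u < snd p"
    using obtain_min_on[OF fins(2) \<open>A2 \<noteq> {}\<close> gop_inj(2)[OF gops(2)]] by blast
  have uA: "x1 < fst u" "fst u < x2" "l < snd u" "snd u < d" using u(1) box by auto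
  have "\<exists>Q. hung t1 u A1 Q \<and> (\<forall>q\<in>Q. snd q = snd u \<and> x1 \<le> fst q \<and> fst q < fst u \<or> inbox a x1 l d q)"
  proof (rule sufficient_left[OF G(1)])
    have "u \<notin> A1" using box(1) uA by fastforce
    then show "snd u \<notin> snd ` A1" by (intro gop_notin(2)[OF gop]) (use u in auto)
  qed (use fins gops card box uA in auto)
  then obtain Q1 where Q1: "hung t1 u A1 Q1"
    "\<forall>q\<in>Q1. snd q = snd u \<and> x1 \<le> fst q \<and> fst q < fst u \<or> inbox a x1 l d q" by blast
  have "\<exists>Q. hung t3 u (A2 - {u}) Q \<and>
    (\<forall>q\<in>Q. fst q = fst u \<and> snd u < snd q \<and> snd q \<le> snd u \<or> inbox x1 x2 (snd u) d q)"
  proof (rule sufficient_up[OF G(2)])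
    show "gop (A2 - {u})" by (rule gop_subset[OF gops(2)]) auto
    show "fst u \<notin> fst ` (A2 - {u})" by (rule gop_notin(1)[OF gops(2)]) (use u in auto)
    show "N3 \<le> card (A2 - {u})" using card u(1) fins by simp
    show "\<forall>p\<in>A2 - {u}. inbox x1 x2 (snd u) d p" using u(2) box(2) by auto
  qed (use fins uA in auto)
  then obtain Q3 where Q3: "hung t3 u (A2 - {u}) Q3" "\<forall>q\<in>Q3. inbox x1 x2 (snd u) d q" by fastforce
  obtain Q2 where Q2: "hung t2 u P Q2"
    "\<forall>q\<in>Q2. inbox a b c d q \<and> (snd q < l \<or> x2 < fst q \<or> snd q = snd u \<and> fst u < fst q)"
    using T2[OF u(1)] by blast
  obtain Q where Q: "hung (Nd r t1 t2 t3) w S Q"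
    "\<And>q. q \<in> Q \<Longrightarrow> q \<in> Q1 \<or> q \<in> Q2 \<or> q \<in> Q3 \<or> snd q = snd w \<and> fst w < fst q \<and> fst q \<le> fst u \<or>
       fst q = fst u \<and> min (snd w) (snd u) \<le> snd q \<and> snd q \<le> max (snd w) (snd u)"
  proof (rule hung_Nd_right[of u S w t1 Q1 t2 Q2 t3 Q3])
    show "hung t1 u S Q1" "hung t2 u S Q2" "hung t3 u S Q3"
      by (rule hung_mono[OF Q1(1)] hung_mono[OF Q2(1)] hung_mono[OF Q3(1)]; use sub in blast)+
    show "Q1 \<inter> Q2 = {}"
    proof (rule Int_emptyI)
      fix q assume "q \<in> Q1" "q \<in> Q2"
      then show False using Q1(2)[rule_format, of q] Q2(2)[rule_format, of q] uA ord by auto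
    qed
    show "Q1 \<inter> Q3 = {}"
    proof (rule Int_emptyI)
      fix q assume "q \<in> Q1" "q \<in> Q3"
      then show False using Q1(2)[rule_format, of q] Q3(2)[rule_format, of q] uA ord by auto
    qed
    show "Q2 \<inter> Q3 = {}"
    proof (rule Int_emptyI)
      fix q assume "q \<in> Q2" "q \<in> Q3"
      then show False using Q2(2)[rule_format, of q] Q3(2)[rule_format, of q] uA ord by auto
    qed
    fix q assume "q \<in> Q1 \<union> Q2 \<union> Q3"
    then show "\<not> (snd q = snd w \<and> fst w < fst q \<and> fst q \<le> fst u)"
      "\<not> (fst q = fst u \<and> min (snd w) (snd u) \<le> snd q \<and> snd q \<le> max (snd w) (snd u))"
      using Q1(2)[rule_format, of q] Q2(2)[rule_format, of q] Q3(2)[rule_format, of q] uA ord by auto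
  qed (use u uA ord sub in auto)
  have "snd q = snd w \<and> fst w < fst q \<and> fst q \<le> a \<or> inbox a b c d q" if "q \<in> Q" for q
    using Q(2)[OF that]
  proof (elim disjE)
    assume "q \<in> Q1"
    then show ?thesis using Q1(2)[rule_format, of q] uA ord by auto
  next
    assume "q \<in> Q2"
    then show ?thesis using Q2(2)[rule_format, of q] by auto
  next
    assume "q \<in> Q3"
    then show ?thesis using Q3(2)[rule_format, of q] uA ord by auto
  qed (use uA ord in auto)
  with Q(1) show ?thesis by blast
qed

text \<open>Here \<open>x3\<close> is where the scan stops. The points above the ray are dealt out
  from left to right: \<open>N1\<close> to \<open>t1\<close>, then \<open>N3 + 1\<close> to the root
  and \<open>t3\<close>, and at least \<open>m\<close> to the heavy path of \<open>t2\<close>. In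
  the second alternative of \<open>alt\<close>, the points passed below the ray play the role of
  \<open>D\<close>.\<close>

lemma sufficient_balanced_above:
  assumes G: "sufficient t1 N1" "sufficient t2 N2" "sufficient t3 N3" and K: "sufficient_back t2 e m z"
    and S: "finite S" "gop S" "snd w \<notin> snd ` S" "\<forall>p\<in>S. inbox a b c d p"
    and ord: "fst w \<le> a" "c < snd w" "snd w < d" "a < x3" "x3 < b"
    and x3: "\<forall>p\<in>S. fst p \<noteq> x3"
    and cU: "N1 + N3 + 1 + m \<le> card {p\<in>S. fst p < x3 \<and> snd w < snd p}"
    and alt: "N2 \<le> card {p\<in>S. x3 < fst p} \<or>
      e \<le> card {p\<in>S. fst p < x3 \<and> snd p < snd w} \<and> z \<le> card {p\<in>S. x3 < fst p}"
  shows "\<exists>Q. hung (Nd r t1 t2 t3) w S Q \<and> (\<forall>q\<in>Q. snd q = snd w \<and> fst w < fst q \<and> fst q \<le> a \<or> inbox a b c d q)"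
proof -
  define U where "U = {p\<in>S. fst p < x3 \<and> snd w < snd p}"
  define D where "D = {p\<in>S. fst p < x3 \<and> snd p < snd w}"
  define Z where "Z = {p\<in>S. x3 < fst p}"
  have fin: "finite U" "finite D" "finite Z" using S(1) by (auto simp: U_def D_def Z_def)
  have "gop U" by (rule gop_subset[OF S(2)]) (auto simp: U_def)
  obtain x1 where x1: "a < x1" "x1 < x3" "\<forall>p\<in>U. fst p \<noteq> x1" "card {p\<in>U. fst p < x1} = N1"
    "card {p\<in>U. x1 < fst p} = card U - N1"
    by (rule separate[of U fst a x3 N1])
       (use fin gop_inj(1)[OF \<open>gop U\<close>] ord cU S(4) in \<open>auto simp: U_def\<close>)
  define A1 where "A1 = {p\<in>U. fst p < x1}"
  define U' where "U' = {p\<in>U. x1 < fst p}"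
  have cU': "N3 + 1 + m \<le> card U'" using x1(5) cU by (simp add: U'_def U_def[symmetric])
  have "gop U'" by (rule gop_subset[OF S(2)]) (auto simp: U_def U'_def)
  have U': "finite U'" "\<forall>p\<in>U'. x1 < fst p \<and> fst p < x3"
    using fin(1) by (simp add: U'_def) (auto simp: U'_def U_def)
  obtain x2 where x2: "x1 < x2" "x2 < x3" "\<forall>p\<in>U'. fst p \<noteq> x2" "card {p\<in>U'. fst p < x2} = N3 + 1"
    "card {p\<in>U'. x2 < fst p} = card U' - (N3 + 1)"
    by (rule separate[of U' fst x1 x3 "N3 + 1"])
       (use gop_inj(1)[OF \<open>gop U'\<close>] x1(2) cU' U' in auto)
  define A2 where "A2 = {p\<in>U'. fst p < x2}"
  define A3 where "A3 = {p\<in>U'. x2 < fst p}"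
  note defs = U_def D_def Z_def A1_def U'_def A2_def A3_def
  have fins: "finite A1" "finite A2" "finite A3" using fin by (auto simp: A1_def A2_def A3_def U'_def)
  have m: "m \<le> card A3" using x2(5) cU' by (simp add: A3_def)
  show ?thesis
  proof (rule hung_Nd_up[OF G(1,3), of A1 A2 a x1 "snd w" d x2 w b c "A3 \<union> D \<union> Z" S])
    show "gop (A1 \<union> A2)" by (rule gop_subset[OF S(2)]) (auto simp: defs)
    show "N1 \<le> card A1" "N3 + 1 \<le> card A2" using x1 x2 by (simp_all add: A1_def A2_def)
    fix u assume u: "u \<in> A2"
    then have uS: "u \<in> S" "x1 < fst u" "fst u < x2" "snd w < snd u" "snd u < d" using S(4) by (auto simp: defs)
    have gopP: "gop (A3 \<union> D \<union> Z)" by (rule gop_subset[OF S(2)]) (auto simp: defs)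
    have un: "snd u \<notin> snd ` (A3 \<union> D \<union> Z)"
      by (rule gop_notin(2)[OF S(2)]) (use u x2 in \<open>auto simp: defs\<close>)
    show "\<exists>Q. hung t2 u (A3 \<union> D \<union> Z) Q \<and>
      (\<forall>q\<in>Q. inbox a b c d q \<and> (snd q < snd w \<or> x2 < fst q \<or> snd q = snd u \<and> fst u < fst q))"
      using alt unfolding D_def[symmetric] Z_def[symmetric]
    proof (elim disjE conjE)
      assume "N2 \<le> card Z"
      have "\<exists>Q. hung t2 u Z Q \<and> (\<forall>q\<in>Q. snd q = snd u \<and> fst u < fst q \<and> fst q \<le> x3 \<or> inbox x3 b c d q)"
      proof (rule sufficient_right[OF G(2)])
        show "gop Z" by (rule gop_subset[OF gopP]) auto
        show "\<forall>p\<in>Z. inbox x3 b c d p" using S(4) by (auto simp: Z_def)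
      qed (use \<open>N2 \<le> card Z\<close> fin un uS x2 ord in auto)
      then obtain Q where Q: "hung t2 u Z Q"
        "\<forall>q\<in>Q. snd q = snd u \<and> fst u < fst q \<and> fst q \<le> x3 \<or> inbox x3 b c d q" by blast
      have "hung t2 u (A3 \<union> D \<union> Z) Q" by (rule hung_mono[OF Q(1)]) auto
      moreover have "inbox a b c d q \<and> (snd q < snd w \<or> x2 < fst q \<or> snd q = snd u \<and> fst u < fst q)"
        if "q \<in> Q" for q
        using Q(2)[rule_format, OF that] uS x1 x2 ord by auto
      ultimately show ?thesis by blast
    next
      assume "e \<le> card D" "z \<le> card Z"
      obtain Q where "hung t2 u (A3 \<union> D \<union> Z) Q"
        "\<And>q. q \<in> Q \<Longrightarrow> inbox a b c d q \<and> (snd q < snd w \<or> x2 < fst q \<or> snd q = snd u \<and> fst u < fst q)"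
      proof (rule sufficient_backE[OF K _ gopP un, of "snd w" x2 x3 d a c b])
        show "snd w \<notin> snd ` Z" using S(3) by (auto simp: Z_def)
      qed (use \<open>e \<le> card D\<close> \<open>z \<le> card Z\<close> m fin fins S(4) ord uS x1 x2 in \<open>auto simp: defs\<close>)
      then show ?thesis by blast
    qed
  qed (use fins S(4) ord x1 x2 in \<open>auto simp: defs\<close>)
qed

lemma card_refined_split:
  fixes S :: "point set"
  assumes "finite S" "\<forall>p\<in>S. fst p \<noteq> x" "\<forall>p\<in>S. snd p \<noteq> y"
  shows "card S = card {p\<in>S. fst p < x \<and> y < snd p} + card {p\<in>S. fst p < x \<and> snd p < y} + card {p\<in>S. x < fst p}"
proof -
  have "S = ({p\<in>S. fst p < x \<and> y < snd p} \<union> {p\<in>S. fst p < x \<and> snd p < y}) \<union> {p\<in>S. x < fst p}"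
  proof -
    have "(fst p < x \<or> x < fst p) \<and> (snd p < y \<or> y < snd p)" if "p \<in> S" for p
      using assms(2,3) that by (metis neq_iff)
    then show ?thesis by blast
  qed
  also have "card \<dots> = card ({p\<in>S. fst p < x \<and> y < snd p} \<union> {p\<in>S. fst p < x \<and> snd p < y}) + card {p\<in>S. x < fst p}"
    by (rule card_Un_disjoint) (use assms(1) in auto)
  also have "card ({p\<in>S. fst p < x \<and> y < snd p} \<union> {p\<in>S. fst p < x \<and> snd p < y}) =
      card {p\<in>S. fst p < x \<and> y < snd p} + card {p\<in>S. fst p < x \<and> snd p < y}"
    by (rule card_Un_disjoint) (use assms(1) in auto)
  finally show ?thesis .
qed

text \<open>Stop the scan when one side of the ray contains \<open>M = N1 + N3 + 1 + m\<close>
  points; the other side then has some \<open>v <= M\<close>. If \<open>v >= e\<close>, at least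
  \<open>N - 2 * M >= z\<close> points remain to the right, and \<open>t2\<close> reaches back. If
  \<open>v < e\<close>, at least \<open>N - M - e >= N2\<close> remain, and \<open>t2\<close> goes
  to the right. These are the two conditions on \<open>N\<close>.\<close>

lemma sufficient_balanced:
  assumes G: "sufficient t1 N1" "sufficient t2 N2" "sufficient t3 N3" and K: "sufficient_back t2 e m z"
    and N: "2 * (N1 + N3 + 1 + m) + z \<le> N" "N1 + N3 + 1 + m + e + N2 \<le> N"
  shows "sufficient (Nd r t1 t2 t3) N"
  unfolding sufficient_def
proof (intro allI impI, elim conjE)
  fix w :: point and S a b c d
  assume S: "finite S" "gop S" "snd w \<notin> snd ` S" "N \<le> card S"
    "\<forall>p\<in>S. inbox a b c d p" and w: "fst w \<le> a" "c < snd w" "snd w < d"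
  define M where "M = N1 + N3 + 1 + m"
  let ?U = "\<lambda>x. {p\<in>S. fst p < x \<and> snd w < snd p}" and ?D = "\<lambda>x. {p\<in>S. fst p < x \<and> snd p < snd w}"
  let ?R = "\<lambda>x. {p\<in>S. x < fst p}"
  let ?Up = "{p\<in>S. snd w < snd p}" and ?Dn = "{p\<in>S. snd p < snd w}"
  have "S \<noteq> {}" using S(4) N by auto
  then have "a < b" using S(5) by fastforce
  have ne: "\<forall>p\<in>S. snd p \<noteq> snd w" using S(3) by (auto simp: image_iff)
  have "card S = card ?Up + card {p\<in>S. \<not> snd w < snd p}"
    using card_inter_split[OF S(1), of "\<lambda>p. snd w < snd p"] .
  also have "{p\<in>S. \<not> snd w < snd p} = ?Dn" using ne by (auto simp: neq_iff)
  finally have cS: "card S = card ?Up + card ?Dn" .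
  have sepU: "\<exists>x. a < x \<and> x < b \<and> (\<forall>p\<in>S. fst p \<noteq> x) \<and> card (?U x) = M" if *: "M \<le> card ?Up"
  proof -
    obtain x where x: "a < x" "x < b" "\<forall>p\<in>S. fst p \<noteq> x" "card {p\<in>?Up. fst p < x} = M"
      by (rule separate_avoiding[of S ?Up fst a b M])
         (use * S \<open>a < b\<close> gop_inj(1)[OF S(2)] in \<open>auto intro: inj_on_subset\<close>)
    moreover have "{p\<in>?Up. fst p < x} = ?U x" by auto
    ultimately show ?thesis by auto
  qed
  have sepD: "\<exists>x. a < x \<and> x < b \<and> (\<forall>p\<in>S. fst p \<noteq> x) \<and> card (?D x) = M" if *: "M \<le> card ?Dn"
  proof -
    obtain x where x: "a < x" "x < b" "\<forall>p\<in>S. fst p \<noteq> x" "card {p\<in>?Dn. fst p < x} = M"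
      by (rule separate_avoiding[of S ?Dn fst a b M])
         (use * S \<open>a < b\<close> gop_inj(1)[OF S(2)] in \<open>auto intro: inj_on_subset\<close>)
    moreover have "{p\<in>?Dn. fst p < x} = ?D x" by auto
    ultimately show ?thesis by auto
  qed
  have le: "card (?U x) \<le> card (?U y)" "card (?D x) \<le> card (?D y)" if "x \<le> y" for x y
    using that by (auto intro!: card_mono S(1) simp: S(1))
  have le': "card (?U x) \<le> card ?Up" "card (?D x) \<le> card ?Dn" for x
    by (auto intro!: card_mono S(1) simp: S(1))
  have "\<exists>x. a < x \<and> x < b \<and> (\<forall>p\<in>S. fst p \<noteq> x) \<and>
    (card (?U x) = M \<and> card (?D x) \<le> M \<or> card (?D x) = M \<and> card (?U x) \<le> M)"
  proof (cases "M \<le> card ?Up")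
    case True
    then obtain x where x: "a < x" "x < b" "\<forall>p\<in>S. fst p \<noteq> x" "card (?U x) = M" using sepU by blast
    show ?thesis
    proof (cases "M \<le> card ?Dn")
      case True
      then obtain y where y: "a < y" "y < b" "\<forall>p\<in>S. fst p \<noteq> y" "card (?D y) = M" using sepD by blast
      show ?thesis
      proof (cases "x \<le> y")
        case True
        then show ?thesis using x y(4) le(2)[OF True] by (intro exI[of _ x]) simp
      next
        case False
        then show ?thesis using y x(4) le(1)[of y x] by (intro exI[of _ y]) simp
      qed
    next
      case False
      then show ?thesis using x le'(2)[of x] by (intro exI[of _ x]) simp
    qed
  next
    case False
    have "2 * M + z \<le> N" using N(1) by (simp only: M_def)
    then have "2 * M \<le> card ?Up + card ?Dn" using cS S(4) by simp
    then have "M \<le> card ?Dn" using False by simp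
    then obtain y where y: "a < y" "y < b" "\<forall>p\<in>S. fst p \<noteq> y" "card (?D y) = M" using sepD by blast
    then show ?thesis using False le'(1)[of y] by (intro exI[of _ y]) simp
  qed
  then obtain x where x: "a < x" "x < b" "\<forall>p\<in>S. fst p \<noteq> x"
    "card (?U x) = M \<and> card (?D x) \<le> M \<or> card (?D x) = M \<and> card (?U x) \<le> M" by blast
  have split: "card S = card (?U x) + card (?D x) + card (?R x)"
    using card_refined_split[OF S(1) x(3) ne] .
  have N': "2 * M + z \<le> N" "M + e + N2 \<le> N" using N by (simp_all only: M_def)
  have arith: "N2 \<le> r \<or> e \<le> v \<and> z \<le> r"
    if "u = M" "v \<le> M" "card S = u + v + r" for u v r
    using that S(4) N' by (cases "e \<le> v") auto
  from x(4) show "\<exists>Q. hung (Nd r t1 t2 t3) w S Q \<and>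
    (\<forall>q\<in>Q. snd q = snd w \<and> fst w < fst q \<and> fst q \<le> a \<or> inbox a b c d q)"
  proof (elim disjE conjE)
    assume U: "card (?U x) = M" "card (?D x) \<le> M"
    have "N2 \<le> card (?R x) \<or> e \<le> card (?D x) \<and> z \<le> card (?R x)"
      by (rule arith[OF U split])
    then show ?thesis
      using sufficient_balanced_above[OF G K S(1-3,5) w x(1-3)] U(1) unfolding M_def by simp
  next
    assume D: "card (?D x) = M" "card (?U x) \<le> M"
    have alt: "N2 \<le> card (?R x) \<or> e \<le> card (?U x) \<and> z \<le> card (?R x)"
      by (rule arith[OF D]) (simp add: split)
    have im: "{p \<in> negy ` S. fst p < x \<and> snd (negy w) < snd p} = negy ` ?D x"
      "{p \<in> negy ` S. fst p < x \<and> snd p < snd (negy w)} = negy ` ?U x"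
      "{p \<in> negy ` S. x < fst p} = negy ` ?R x" by auto
    have cim: "card (negy ` X) = card X" for X by (simp add: card_image inj_on_subset[OF inj_invols(2)])
    have ny: "snd (negy w) \<notin> snd ` negy ` S" using S(3) by (auto simp: image_iff)
    have "\<exists>Q. hung (Nd r t1 t2 t3) (negy w) (negy ` S) Q \<and>
      (\<forall>q\<in>Q. snd q = snd (negy w) \<and> fst (negy w) < fst q \<and> fst q \<le> a \<or> inbox a b (-d) (-c) q)"
      by (rule sufficient_balanced_above[OF G K, where ?x3.0 = x])
         (use S w x ny alt D in \<open>simp_all add: gop_negy im cim M_def del: fst_snd_negs\<close>, simp_all)
    then obtain Q where Q: "hung (Nd r t1 t2 t3) (negy w) (negy ` S) Q"
      "\<forall>q\<in>Q. snd q = snd (negy w) \<and> fst (negy w) < fst q \<and> fst q \<le> a \<or> inbox a b (-d) (-c) q" by blast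
    have "hung (Nd r t1 t2 t3) w S (negy ` Q)" using hung_negy[OF Q(1)] by simp
    with Q(2) show ?thesis by (intro exI[of _ "negy ` Q"]) auto
  qed
qed

subsection \<open>Estimates for the power 1.55\<close>

text \<open>As 1.55 = 31/20, taking 20th powers turns the estimate into an inequality between
  integer powers, decidable by computation for rationals.\<close>

lemma powr_le_rational:
  fixes x u :: real
  assumes "0 < x" "0 \<le> u" "x ^ 31 \<le> u ^ 20"
  shows "x powr 1.55 \<le> u"
proof -
  have "(x powr 1.55) ^ 20 = (x powr 1.55) powr real 20"
    using assms(1) by (subst powr_realpow) auto
  also have "\<dots> = x powr real 31" by (simp add: powr_powr)
  also have "\<dots> = x ^ 31" by (rule powr_realpow[OF assms(1)])
  finally have "(x powr 1.55) ^ 20 \<le> u ^ 20" using assms(3) by simp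
  then show ?thesis using assms(2) by (simp add: power_mono_iff)
qed

text \<open>A convex function lies below its chords, here with upper bounds \<open>u\<close>,
  \<open>v\<close> for the values at the ends. This makes the later estimates linear.\<close>

lemma powr_chord:
  fixes x :: real
  assumes "0 < a" "a < b" "a \<le> x" "x \<le> b" "a powr 1.55 \<le> u" "b powr 1.55 \<le> v"
  shows "x powr 1.55 \<le> ((b - x) * u + (x - a) * v) / (b - a)"
proof -
  let ?t = "(x - a) / (b - a)"
  have t: "0 \<le> ?t" "?t \<le> 1" using assms(1-4) by auto
  have "?t * (b - a) = x - a" using assms(2) by simp
  then have x: "(1 - ?t) *\<^sub>R a + ?t *\<^sub>R b = x" 
  proof -
    have *: "(1 - s) * a + s * b = a + s * (b - a)" for s by (simp add: algebra_simps)
    show ?thesis unfolding real_scaleR_def * using \<open>?t * (b - a) = x - a\<close> by linarith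
  qed
  have "x powr 1.55 \<le> (1 - ?t) * a powr 1.55 + ?t * b powr 1.55"
    using convex_onD[OF powr_convex[of "1.55"] t, of a b] assms(1,2) unfolding x by simp
  also have "\<dots> \<le> (1 - ?t) * u + ?t * v"
    by (intro add_mono mult_left_mono assms) (use t in auto)
  also have "\<dots> = ((b - x) * u + (x - a) * v) / (b - a)"
  proof -
    have "1 - ?t = (b - x) / (b - a)" using assms(2) by (simp add: diff_divide_eq_iff)
    then show ?thesis by (simp add: add_divide_distrib)
  qed
  finally show ?thesis .
qed

lemma powr_le_fraction:
  fixes p q r s :: nat
  assumes "0 < p" "0 < q" "0 < s" "p ^ 31 * s ^ 20 \<le> r ^ 20 * q ^ 31"
  shows "(real p / real q) powr 1.55 \<le> real r / real s"
proof (rule powr_le_rational)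
  have "real p ^ 31 * real s ^ 20 \<le> real r ^ 20 * real q ^ 31"
    using assms(4) by (metis of_nat_le_iff of_nat_mult of_nat_power)
  then show "(real p / real q) ^ 31 \<le> (real r / real s) ^ 20"
    using assms(2,3) by (simp add: power_divide frac_le_eq divide_le_eq pos_divide_le_eq pos_le_divide_eq)
qed (use assms in auto)

lemma powr_node_bounds:
  "(1/10::real) powr 1.55 \<le> 282/10000" "(3/10::real) powr 1.55 \<le> 1548/10000" "(5/10::real) powr 1.55 \<le> 3416/10000"
  "(7/10::real) powr 1.55 \<le> 5754/10000" "(9/10::real) powr 1.55 \<le> 8494/10000" "(1::real) powr 1.55 \<le> 1"
proof -
  show "(1/10::real) powr 1.55 \<le> 282/10000" using powr_le_fraction[of 1 10 10000 282] by simp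
  show "(3/10::real) powr 1.55 \<le> 1548/10000" using powr_le_fraction[of 3 10 10000 1548] by simp
  show "(5/10::real) powr 1.55 \<le> 3416/10000" using powr_le_fraction[of 5 10 10000 3416] by simp
  show "(7/10::real) powr 1.55 \<le> 5754/10000" using powr_le_fraction[of 7 10 10000 5754] by simp
  show "(9/10::real) powr 1.55 \<le> 8494/10000" using powr_le_fraction[of 9 10 10000 8494] by simp
qed simp

lemma powr_split: "y powr 1.55 = y * y powr 0.55" if "0 \<le> y" for y :: real
proof -
  have "y powr 1.55 = y powr (1 + 0.55)" by (rule arg_cong[of _ _ "(powr) y"]) simp
  also have "\<dots> = y powr 1 * y powr 0.55" by (rule powr_add)
  finally show ?thesis using that by (simp only: powr_one)
qed

lemma powr_ratio:
  fixes x :: real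
  assumes "0 \<le> x" "x \<le> b" "0 < b" "b powr 1.55 \<le> u"
  shows "x powr 1.55 \<le> u / b * x"
proof -
  have "x powr 0.55 \<le> b powr 0.55" by (rule powr_mono2) (use assms in auto)
  then have "x powr 1.55 \<le> x * b powr 0.55"
    unfolding powr_split[OF assms(1)] by (rule mult_left_mono) (rule assms(1))
  also have "\<dots> \<le> x * (u / b)"
  proof (rule mult_left_mono)
    show "b powr 0.55 \<le> u / b"
      using assms(3,4) powr_split[of b] by (simp add: pos_le_divide_eq mult.commute)
  qed (rule assms(1))
  finally show ?thesis by (simp add: mult.commute)
qed

text \<open>Chords between the nodes 0, 1/10, 3/10, 5/10, 7/10, 9/10, 1, with slopes rounded up
  where necessary. The chords from 0 come from the monotonicity of the power 0.55.\<close>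

lemma powr_bounds:
  fixes x :: real
  shows "0 \<le> x \<Longrightarrow> x \<le> 1/10 \<Longrightarrow> x powr 1.55 \<le> 282/1000 * x"
    and "0 \<le> x \<Longrightarrow> x \<le> 3/10 \<Longrightarrow> x powr 1.55 \<le> 516/1000 * x"
    and "1/10 \<le> x \<Longrightarrow> x \<le> 3/10 \<Longrightarrow> x powr 1.55 \<le> 282/10000 + 633/1000 * (x - 1/10)"
    and "3/10 \<le> x \<Longrightarrow> x \<le> 5/10 \<Longrightarrow> x powr 1.55 \<le> 1548/10000 + 934/1000 * (x - 3/10)"
    and "3/10 \<le> x \<Longrightarrow> x \<le> 7/10 \<Longrightarrow> x powr 1.55 \<le> 1548/10000 + 10515/10000 * (x - 3/10)"
    and "3/10 \<le> x \<Longrightarrow> x \<le> 9/10 \<Longrightarrow> x powr 1.55 \<le> 1548/10000 + 11577/10000 * (x - 3/10)"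
    and "5/10 \<le> x \<Longrightarrow> x \<le> 7/10 \<Longrightarrow> x powr 1.55 \<le> 3416/10000 + 1169/1000 * (x - 5/10)"
    and "9/10 \<le> x \<Longrightarrow> x \<le> 1 \<Longrightarrow> x powr 1.55 \<le> 8494/10000 + 1506/1000 * (x - 9/10)"
  using powr_ratio[OF _ _ _ powr_node_bounds(1), of x]
  apply simp
  using powr_ratio[OF _ _ _ powr_node_bounds(2), of x]
  apply simp
  using powr_chord[OF _ _ _ _ powr_node_bounds(1,2), of x]
  apply (simp add: field_simps)
  using powr_chord[OF _ _ _ _ powr_node_bounds(2,3), of x]
  apply (simp add: field_simps)
  using powr_chord[OF _ _ _ _ powr_node_bounds(2,4), of x]
  apply (simp add: field_simps)
  using powr_chord[OF _ _ _ _ powr_node_bounds(2,5), of x]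
  apply (simp add: field_simps)
  using powr_chord[OF _ _ _ _ powr_node_bounds(3,4), of x]
  apply (simp add: field_simps)
  using powr_chord[OF _ _ _ _ powr_node_bounds(5,6), of x]
  apply (simp add: field_simps)
  done

text \<open>The outcomes match the ways to keep a tree economical: saving four percent, splitting
  evenly, or following a heavy child. A split costs \<open>J1 + J2 + 3 * J3 + 1\<close> with each
  \<open>J\<close> about twice a power, so 75/100 is half of the budget 15/10. In a path step a
  light subtree enters the cost with factor 8: a 2 from its own bound, a 2 from the unknown side of
  the ray, and a 2 because \<open>m\<close> counts twice; 16/3 is 8 divided by 15/10.\<close>

lemma powr_trichotomy:
  fixes x y z :: real
  assumes "0 \<le> z" "z \<le> y" "y \<le> x" "x + y + z \<le> 1"
  shows "x powr 1.55 + 2 * y powr 1.55 + 2 * z powr 1.55 \<le> 96/100 \<or>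
    x powr 1.55 + y powr 1.55 + 3 * z powr 1.55 \<le> 75/100 \<and> 3/10 \<le> y \<and> z \<le> 1/10 \<and> x \<le> 7/10 \<or>
    x powr 1.55 + 16 / 3 * (y powr 1.55 + z powr 1.55) \<le> 1 \<and> 9/10 \<le> x"
proof -
  consider "9/10 \<le> x" | "x \<le> 9/10" "3/10 \<le> x" "y \<le> 3/10" | "x < 3/10"
    | "3/10 \<le> y" "z \<le> 1/10" | "3/10 \<le> y" "1/10 \<le> z" "z \<le> 3/10" | "3/10 \<le> z"
    using assms by argo
  then show ?thesis
  proof cases
    case 1
    have "x powr 1.55 \<le> 8494/10000 + 1506/1000 * (x - 9/10)" "y powr 1.55 \<le> 282/1000 * y"
      "z powr 1.55 \<le> 282/1000 * z"
      by (rule powr_bounds; use 1 assms in linarith)+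
    then have "x powr 1.55 + 16 / 3 * (y powr 1.55 + z powr 1.55) \<le> 1" using assms by argo
    then show ?thesis using 1 by blast
  next
    case 2
    have "x powr 1.55 \<le> 1548/10000 + 11577/10000 * (x - 3/10)" "y powr 1.55 \<le> 516/1000 * y"
      "z powr 1.55 \<le> 516/1000 * z"
      by (rule powr_bounds; use 2 assms in linarith)+
    then have "x powr 1.55 + 2 * y powr 1.55 + 2 * z powr 1.55 \<le> 96/100" using 2 assms by argo
    then show ?thesis by blast
  next
    case 3
    have "x powr 1.55 \<le> 516/1000 * x" "y powr 1.55 \<le> 516/1000 * y"
      "z powr 1.55 \<le> 516/1000 * z"
      by (rule powr_bounds; use 3 assms in linarith)+
    then have "x powr 1.55 + 2 * y powr 1.55 + 2 * z powr 1.55 \<le> 96/100" using 3 assms by argo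
    then show ?thesis by blast
  next
    case 4
    have "x powr 1.55 \<le> 1548/10000 + 10515/10000 * (x - 3/10)"
      "y powr 1.55 \<le> 1548/10000 + 934/1000 * (y - 3/10)" "z powr 1.55 \<le> 282/1000 * z"
      by (rule powr_bounds; use 4 assms in linarith)+
    then have "x powr 1.55 + y powr 1.55 + 3 * z powr 1.55 \<le> 75/100" using 4 assms by argo
    moreover have "x \<le> 7/10" using 4 assms by linarith
    ultimately show ?thesis using 4 by blast
  next
    case 5
    have "x powr 1.55 \<le> 1548/10000 + 10515/10000 * (x - 3/10)"
      "y powr 1.55 \<le> 1548/10000 + 934/1000 * (y - 3/10)" "z powr 1.55 \<le> 282/10000 + 633/1000 * (z - 1/10)"
      by (rule powr_bounds; use 5 assms in linarith)+
    then have "x powr 1.55 + 2 * y powr 1.55 + 2 * z powr 1.55 \<le> 96/100" using 5 assms by argo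
    then show ?thesis by blast
  next
    case 6
    have "x powr 1.55 \<le> 1548/10000 + 10515/10000 * (x - 3/10)"
      "y powr 1.55 \<le> 1548/10000 + 934/1000 * (y - 3/10)" "z powr 1.55 \<le> 1548/10000 + 934/1000 * (z - 3/10)"
      by (rule powr_bounds; use 6 assms in linarith)+
    then have "x powr 1.55 + 2 * y powr 1.55 + 2 * z powr 1.55 \<le> 96/100" using 6 assms by argo
    then show ?thesis by blast
  qed
qed

text \<open>Only the middle outcome of the trichotomy can violate the plain recursion. The other
  inequalities belong to the two remedies. The first is the recursion with a second subtree that
  saves four percent. The next two are the conditions of \<open>sufficient_balanced\<close> with
  \<open>2 * m + z\<close> and \<open>m + e\<close> at most 15/10 of the power of \<open>y\<close>.
  The first two are divided by 2, and \<open>v\<close> is the share of the root.\<close>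

lemma powr_standard_or_balanced:
  fixes x y z v :: real
  assumes "0 \<le> z" "z \<le> y" "y \<le> x" "0 \<le> v" "x + y + z + v = 1"
  shows "x powr 1.55 + 2 * y powr 1.55 + 2 * z powr 1.55 \<le> 1 \<or>
    x powr 1.55 + 192/100 * y powr 1.55 + 2 * z powr 1.55 \<le> 1 - v / 2 \<and>
    2 * x powr 1.55 + 75/100 * y powr 1.55 + 2 * z powr 1.55 \<le> 1 - v / 2 \<and>
    2 * x powr 1.55 + 35/10 * y powr 1.55 + 2 * z powr 1.55 \<le> 2"
proof -
  have "x + y + z \<le> 1" using assms by linarith
  from powr_trichotomy[OF assms(1-3) this] show ?thesis
  proof (elim disjE conjE)
    assume *: "3/10 \<le> y" "z \<le> 1/10" "x \<le> 7/10"
    have yz: "y powr 1.55 \<le> 1548/10000 + 934/1000 * (y - 3/10)" "z powr 1.55 \<le> 282/1000 * z"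
      by (rule powr_bounds; use * assms in linarith)+
    \<comment> \<open>The threshold 536/1000 has little room: for z = v = 0 these linear bounds give
      the plain recursion only from about 0.5355 on, and the second balanced inequality only up to
      about 0.537.\<close>
    consider "x \<le> 5/10" | "5/10 \<le> x" "x \<le> 536/1000" | "536/1000 \<le> x" by argo
    then show ?thesis
    proof cases
      case 1
      have "x powr 1.55 \<le> 1548/10000 + 934/1000 * (x - 3/10)"
        by (rule powr_bounds; use 1 * assms in linarith)
      with yz have "x powr 1.55 + 192/100 * y powr 1.55 + 2 * z powr 1.55 \<le> 1 - v / 2"
        "2 * x powr 1.55 + 75/100 * y powr 1.55 + 2 * z powr 1.55 \<le> 1 - v / 2"
        "2 * x powr 1.55 + 35/10 * y powr 1.55 + 2 * z powr 1.55 \<le> 2"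
        using 1 * assms by argo+
      then show ?thesis by blast
    next
      case 2
      have "x powr 1.55 \<le> 3416/10000 + 1169/1000 * (x - 5/10)"
        by (rule powr_bounds; use 2 * assms in linarith)
      with yz have "x powr 1.55 + 192/100 * y powr 1.55 + 2 * z powr 1.55 \<le> 1 - v / 2"
        "2 * x powr 1.55 + 75/100 * y powr 1.55 + 2 * z powr 1.55 \<le> 1 - v / 2"
        "2 * x powr 1.55 + 35/10 * y powr 1.55 + 2 * z powr 1.55 \<le> 2"
        using 2 * assms by argo+
      then show ?thesis by blast
    next
      case 3
      have "x powr 1.55 \<le> 3416/10000 + 1169/1000 * (x - 5/10)"
        by (rule powr_bounds; use 3 * assms in linarith)
      with yz have "x powr 1.55 + 2 * y powr 1.55 + 2 * z powr 1.55 \<le> 1"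
        using 3 * assms by argo
      then show ?thesis by blast
    qed
  next
    assume *: "9/10 \<le> x"
    have "x powr 1.55 \<le> 8494/10000 + 1506/1000 * (x - 9/10)" "y powr 1.55 \<le> 282/1000 * y"
      "z powr 1.55 \<le> 282/1000 * z"
      by (rule powr_bounds; use * assms in linarith)+
    then have "x powr 1.55 + 2 * y powr 1.55 + 2 * z powr 1.55 \<le> 1" using assms by argo
    then show ?thesis by blast
  qed argo
qed

section \<open>The estimates in terms of numbers of vertices\<close>

abbreviation ph :: "nat \<Rightarrow> real" where
  "ph n \<equiv> real n powr 1.55"

lemma ph_ge: "real n \<le> ph n"
proof (cases "n = 0")
  case False
  then have "real n powr 1 \<le> real n powr 1.55" by (intro powr_mono) auto
  then show ?thesis using False by simp
qed simp

text \<open>The increment is at least \<open>(n + 1) powr 0.55\<close>, which is at least sqrt 2.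
  The constant 4/3 is what a path step without light subtrees consumes: \<open>2 * m + z\<close>
  grows by 2, which is 15/10 * 4/3.\<close>

lemma ph_Suc: "1 \<le> n \<Longrightarrow> ph n + 4 / 3 \<le> ph (n + 1)"
proof -
  assume n: "1 \<le> n"
  have "(4 / 3 :: real) \<le> sqrt 2" by (rule real_le_rsqrt) (simp add: power2_eq_square)
  also have "sqrt 2 = 2 powr (1 / 2)" by (rule powr_half_sqrt[symmetric]) simp
  also have "\<dots> \<le> 2 powr 0.55" by (rule powr_mono) auto
  also have "\<dots> \<le> real (n + 1) powr 0.55" by (rule powr_mono2) (use n in auto)
  finally have q: "4 / 3 \<le> real (n + 1) powr 0.55" .
  have "real n * real n powr 0.55 \<le> real n * real (n + 1) powr 0.55"
    by (intro mult_left_mono powr_mono2) auto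
  then have "real n * real n powr 0.55 + 4 / 3 \<le> real n * real (n + 1) powr 0.55 + real (n + 1) powr 0.55"
    using q by linarith
  then show ?thesis using powr_split[of "real n"] powr_split[of "real (n + 1)"] by (simp add: algebra_simps)
qed

lemma ph_scale: "0 < n \<Longrightarrow> ph m = ph n * (real m / real n) powr 1.55"
  by (simp flip: powr_mult)

lemma ph_trichotomy:
  assumes "n3 \<le> n2" "n2 \<le> n1" "n = n1 + n2 + n3 + 1"
  shows "ph n1 + 2 * ph n2 + 2 * ph n3 \<le> 96/100 * ph n \<or>
    ph n1 + ph n2 + 3 * ph n3 \<le> 75/100 * ph n \<or>
    ph n1 + 16 / 3 * (ph n2 + ph n3) \<le> ph n"
proof -
  let ?x = "real n1 / real n" and ?y = "real n2 / real n" and ?z = "real n3 / real n"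
  have n: "0 < n" using assms by simp
  have s: "ph n1 = ph n * ?x powr 1.55" "ph n2 = ph n * ?y powr 1.55" "ph n3 = ph n * ?z powr 1.55"
    by (rule ph_scale[OF n])+
  have "?x + ?y + ?z \<le> 1"
    using assms n by (simp add: add_divide_distrib[symmetric])
  moreover have "0 \<le> ?z" "?z \<le> ?y" "?y \<le> ?x" using assms n by (auto intro: divide_right_mono)
  ultimately have "?x powr 1.55 + 2 * ?y powr 1.55 + 2 * ?z powr 1.55 \<le> 96/100 \<or>
    ?x powr 1.55 + ?y powr 1.55 + 3 * ?z powr 1.55 \<le> 75/100 \<or>
    ?x powr 1.55 + 16 / 3 * (?y powr 1.55 + ?z powr 1.55) \<le> 1"
    using powr_trichotomy[of ?z ?y ?x] by blast
  then show ?thesis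
  proof (elim disjE)
    assume *: "?x powr 1.55 + 2 * ?y powr 1.55 + 2 * ?z powr 1.55 \<le> 96/100"
    show ?thesis unfolding s using mult_left_mono[OF *, of "ph n"] by (intro disjI1) (simp add: algebra_simps)
  next
    assume *: "?x powr 1.55 + ?y powr 1.55 + 3 * ?z powr 1.55 \<le> 75/100"
    show ?thesis unfolding s using mult_left_mono[OF *, of "ph n"] by (intro disjI2 disjI1) (simp add: algebra_simps)
  next
    assume *: "?x powr 1.55 + 16 / 3 * (?y powr 1.55 + ?z powr 1.55) \<le> 1"
    show ?thesis unfolding s using mult_left_mono[OF *, of "ph n"] by (intro disjI2) (simp add: algebra_simps)
  qed
qed

lemma ph_standard_or_balanced:
  assumes "n3 \<le> n2" "n2 \<le> n1" "n = n1 + n2 + n3 + 1"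
  shows "ph n1 + 2 * ph n2 + 2 * ph n3 \<le> ph n \<or>
    ph n1 + 192/100 * ph n2 + 2 * ph n3 \<le> ph n - 1 / 2 \<and>
    2 * ph n1 + 75/100 * ph n2 + 2 * ph n3 \<le> ph n - 1 / 2 \<and>
    2 * ph n1 + 35/10 * ph n2 + 2 * ph n3 \<le> 2 * ph n"
proof -
  let ?x = "real n1 / real n" and ?y = "real n2 / real n" and ?z = "real n3 / real n" and ?v = "1 / real n"
  have n: "0 < n" using assms by simp
  have s: "ph n1 = ph n * ?x powr 1.55" "ph n2 = ph n * ?y powr 1.55" "ph n3 = ph n * ?z powr 1.55"
    by (rule ph_scale[OF n])+
  have "?x + ?y + ?z + ?v = 1"
    using assms n by (simp add: add_divide_distrib[symmetric])
  moreover have "0 \<le> ?z" "?z \<le> ?y" "?y \<le> ?x" "0 \<le> ?v" using assms n by (auto intro: divide_right_mono)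
  ultimately have "?x powr 1.55 + 2 * ?y powr 1.55 + 2 * ?z powr 1.55 \<le> 1 \<or>
    ?x powr 1.55 + 192/100 * ?y powr 1.55 + 2 * ?z powr 1.55 \<le> 1 - ?v / 2 \<and>
    2 * ?x powr 1.55 + 75/100 * ?y powr 1.55 + 2 * ?z powr 1.55 \<le> 1 - ?v / 2 \<and>
    2 * ?x powr 1.55 + 35/10 * ?y powr 1.55 + 2 * ?z powr 1.55 \<le> 2"
    by (rule powr_standard_or_balanced[rotated 4])
  \<comment> \<open>Since \<open>ph n\<close> is at least \<open>n\<close>, the root's share 1/n is
    worth at least 1/2 after half of it is scaled by \<open>ph n\<close>; doubled, this is the 1
    kept in reserve.\<close>
  moreover have v: "ph n * (1 - ?v / 2) \<le> ph n - 1 / 2"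
    using ph_ge[of n] n by (simp add: field_simps)
  ultimately show ?thesis
  proof (elim disjE conjE)
    assume *: "?x powr 1.55 + 2 * ?y powr 1.55 + 2 * ?z powr 1.55 \<le> 1"
    show ?thesis unfolding s using mult_left_mono[OF *, of "ph n"] by (intro disjI1) (simp add: algebra_simps)
  next
    assume *: "?x powr 1.55 + 192/100 * ?y powr 1.55 + 2 * ?z powr 1.55 \<le> 1 - ?v / 2"
      "2 * ?x powr 1.55 + 75/100 * ?y powr 1.55 + 2 * ?z powr 1.55 \<le> 1 - ?v / 2"
      "2 * ?x powr 1.55 + 35/10 * ?y powr 1.55 + 2 * ?z powr 1.55 \<le> 2"
    have "ph n * (?x powr 1.55 + 192/100 * ?y powr 1.55 + 2 * ?z powr 1.55) \<le> ph n - 1 / 2"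
      "ph n * (2 * ?x powr 1.55 + 75/100 * ?y powr 1.55 + 2 * ?z powr 1.55) \<le> ph n - 1 / 2"
      by (rule order_trans[OF mult_left_mono[OF *(1)] v]; simp)
         (rule order_trans[OF mult_left_mono[OF *(2)] v]; simp)
    moreover have "ph n * (2 * ?x powr 1.55 + 35/10 * ?y powr 1.55 + 2 * ?z powr 1.55) \<le> ph n * 2"
      using mult_left_mono[OF *(3), of "ph n"] by simp
    ultimately show ?thesis unfolding s by (intro disjI2 conjI) (simp_all add: algebra_simps)
  qed
qed

section \<open>The induction over the tree\<close>

lemma hung_swap_iff:
  "hung (Nd r t2 t1 t3) = hung (Nd r t1 t2 t3)"
  "hung (Nd r t1 t3 t2) = hung (Nd r t1 t2 t3)"
  by (intro ext iffI; erule hung_swap12) (intro ext iffI; erule hung_swap23)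

lemma sufficient_swap_iff:
  "sufficient (Nd r t2 t1 t3) = sufficient (Nd r t1 t2 t3)"
  "sufficient (Nd r t1 t3 t2) = sufficient (Nd r t1 t2 t3)"
  by (intro ext; simp only: sufficient_def hung_swap_iff(1)[of r t2 t1] hung_swap_iff(2)[of r t1 t3])+

lemma sufficient_back_swap_iff:
  "sufficient_back (Nd r t2 t1 t3) = sufficient_back (Nd r t1 t2 t3)"
  "sufficient_back (Nd r t1 t3 t2) = sufficient_back (Nd r t1 t2 t3)"
  by (intro ext; simp only: sufficient_back_def hung_swap_iff(1)[of r t2 t1] hung_swap_iff(2)[of r t1 t3])+

text \<open>The recursion for \<^const>\<open>sufficient\<close> exceeds \<^term>\<open>2 * ph n\<close> only if the two largest subtrees have almost
  equal size. The second conjunct handles this case: either the second subtree can be drawn with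
  some points to spare, or its heavy path soon reaches a vertex where it splits evenly.\<close>

definition economical :: "'a tr \<Rightarrow> bool" where
  "economical t \<longleftrightarrow> (\<exists>J. sufficient t J \<and> real J \<le> max 0 (2 * ph (size t) - 1)) \<and>
    ((\<exists>J. sufficient t J \<and> real J \<le> 192/100 * ph (size t)) \<or>
     (\<exists>e m z. sufficient_back t e m z \<and> e \<le> z \<and> real (2 * m + z) \<le> 15/10 * ph (size t)))"

lemma economical_swap:
  "economical (Nd r t2 t1 t3) = economical (Nd r t1 t2 t3)"
  "economical (Nd r t1 t3 t2) = economical (Nd r t1 t2 t3)"
proof -
  have s: "size (Nd r t2 t1 t3) = size (Nd r t1 t2 t3)" "size (Nd r t1 t3 t2) = size (Nd r t1 t2 t3)" by simp_all
  show "economical (Nd r t2 t1 t3) = economical (Nd r t1 t2 t3)"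
    by (simp only: economical_def s(1) sufficient_swap_iff(1)[of r t2 t1] sufficient_back_swap_iff(1)[of r t2 t1])
  show "economical (Nd r t1 t3 t2) = economical (Nd r t1 t2 t3)"
    by (simp only: economical_def s(2) sufficient_swap_iff(2)[of r t1 t3] sufficient_back_swap_iff(2)[of r t1 t3])
qed

text \<open>In the plain recursion the \<open>- 1\<close> in the bound for \<open>J1\<close> absorbs
  the new root, and that for \<open>J2\<close> restores the reserve; if \<open>t2\<close> is empty,
  \<open>ph_Suc\<close> restores it. For the second conjunct, a heavy first child passes on
  whichever alternative it satisfies: a saving by the recursion, a drawing reaching back by one more
  path step.\<close>

lemma economical_Nd_sorted:
  assumes ec: "economical t1" "economical t2" "economical t3"
    and ord: "size t3 \<le> size t2" "size t2 \<le> size t1"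
  shows "economical (Nd r t1 t2 t3)"
proof (cases "size t1 = 0")
  case True
  then have "t1 = Lf" "t2 = Lf" "t3 = Lf" using ord by (cases t1; cases t2; cases t3; simp)+
  moreover have "sufficient (Nd r Lf Lf Lf :: 'a tr) 1"
    using sufficient_Nd[OF sufficient_Lf[of 0] sufficient_Lf[of 0] sufficient_Lf[of 0]] by simp
  ultimately show ?thesis unfolding economical_def
    by (intro conjI disjI1 exI[of _ 1]) simp_all
next
  case False
  define n n1 n2 n3 where n: "n = size (Nd r t1 t2 t3)" "n1 = size t1" "n2 = size t2" "n3 = size t3"
  have ns: "n3 \<le> n2" "n2 \<le> n1" "n = n1 + n2 + n3 + 1" "1 \<le> n1" using ord False by (auto simp: n)
  have pos: "0 \<le> ph n2" "0 \<le> ph n3" and p1: "1 \<le> ph n1"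
    using ph_ge[of n1] ns(4) by auto
  obtain J1 where J1': "sufficient t1 J1" "real J1 \<le> max 0 (2 * ph n1 - 1)"
    using ec(1) unfolding economical_def n by blast
  obtain J2 where J2'': "sufficient t2 J2" and J2': "real J2 \<le> max 0 (2 * ph n2 - 1)"
    using ec(2) unfolding economical_def n by blast
  obtain J3 where J3'': "sufficient t3 J3" and J3': "real J3 \<le> max 0 (2 * ph n3 - 1)"
    using ec(3) unfolding economical_def n by blast
  note J = J1'(1) J2'' J3''
  have J1: "real J1 \<le> 2 * ph n1 - 1" using J1'(2) p1 by simp
  have J3: "real J3 \<le> 2 * ph n3" and J2w: "real J2 \<le> 2 * ph n2"
    using J2' J3' pos by (auto simp: max_def split: if_splits)
  have J2: "real J2 \<le> 2 * ph n2 - 1" if "1 \<le> n2"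
    using J2' ph_ge[of n2] that by simp
  have J20: "J2 = 0 \<and> J3 = 0" and n20: "ph n2 = 0 \<and> ph n3 = 0" and n20': "n = n1 + 1" if "n2 = 0"
    using J2' J3' that ns by auto
  have std: "sufficient (Nd r t1 t2 t3) (J + 2 * J2 + 2 * J3 + 1)" if "sufficient t1 J" for J
    by (rule sufficient_Nd[OF that J(2,3)])
  have step: "ph n1 + 4 / 3 \<le> ph n" if "n2 = 0" using ph_Suc[OF ns(4)] n20'[OF that] by simp
  have first: "\<exists>J. sufficient (Nd r t1 t2 t3) J \<and> real J \<le> 2 * ph n - 1"
  proof (cases "n2 = 0")
    case True
    then show ?thesis using std[OF J(1)] J1 J20 step by (intro exI[of _ "J1 + 2 * J2 + 2 * J3 + 1"]) simp
  next
    case n2: False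
    from ph_standard_or_balanced[OF ns(1-3)] show ?thesis
    proof (elim disjE conjE)
      assume "ph n1 + 2 * ph n2 + 2 * ph n3 \<le> ph n"
      then have "real (J1 + 2 * J2 + 2 * J3 + 1) \<le> 2 * ph n - 1"
        using J1 J2 J3 n2 by simp
      then show ?thesis using std[OF J(1)] by blast
    next
      assume bal: "ph n1 + 192/100 * ph n2 + 2 * ph n3 \<le> ph n - 1 / 2"
        "2 * ph n1 + 75/100 * ph n2 + 2 * ph n3 \<le> ph n - 1 / 2"
        "2 * ph n1 + 35/10 * ph n2 + 2 * ph n3 \<le> 2 * ph n"
      from ec(2) consider J where "sufficient t2 J" "real J \<le> 192/100 * ph n2"
        | e m z where "sufficient_back t2 e m z" "e \<le> z" "real (2 * m + z) \<le> 15/10 * ph n2"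
        unfolding economical_def n by blast
      then show ?thesis
      proof cases
        case 1
        have "real (J1 + 2 * J + 2 * J3 + 1) \<le> 2 * ph n - 1"
          using J1 1(2) J3 bal(1) by simp
        then show ?thesis using sufficient_Nd[OF J(1) 1(1) J(3)] by blast
      next
        case 2
        \<comment> \<open>As \<open>e <= z\<close>, also \<open>m + e <= 2 * m + z\<close>, so the
          single budget 15/10 controls both conditions of
          \<open>sufficient_balanced\<close>.\<close>
        let ?N = "max (2 * (J1 + J3 + 1 + m) + z) (J1 + J3 + 1 + m + e + J2)"
        have "sufficient (Nd r t1 t2 t3) ?N" by (rule sufficient_balanced[OF J 2(1)]) auto
        moreover have "real (2 * (J1 + J3 + 1 + m) + z) \<le> 2 * ph n - 1"
          using J1 J3 2(3) bal(2) by simp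
        moreover have "real (J1 + J3 + 1 + m + e + J2) \<le> 2 * ph n - 1"
          using J1 J3 J2 n2 2(2,3) bal(3) by simp
        ultimately show ?thesis by (intro exI[of _ ?N]) simp
      qed
    qed
  qed
  have second: "(\<exists>J. sufficient (Nd r t1 t2 t3) J \<and> real J \<le> 192/100 * ph n) \<or>
     (\<exists>e m z. sufficient_back (Nd r t1 t2 t3) e m z \<and> e \<le> z \<and> real (2 * m + z) \<le> 15/10 * ph n)"
    using ph_trichotomy[OF ns(1-3)]
  proof (elim disjE)
    assume *: "ph n1 + 2 * ph n2 + 2 * ph n3 \<le> 96/100 * ph n"
    have "real (J1 + 2 * J2 + 2 * J3 + 1) \<le> 192/100 * ph n" using J1 J2w J3 * by simp
    then show ?thesis using std[OF J(1)] by blast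
  next
    assume *: "ph n1 + ph n2 + 3 * ph n3 \<le> 75/100 * ph n"
    have "real (2 * 0 + (J1 + J2 + 3 * J3 + 1)) \<le> 15/10 * ph n" using J1 J2w J3 * by simp
    then show ?thesis using sufficient_back_split[OF J, of r]
      by (intro disjI2 exI[of _ J2] exI[of _ 0] exI[of _ "J1 + J2 + 3 * J3 + 1"]) simp
  next
    assume *: "ph n1 + 16 / 3 * (ph n2 + ph n3) \<le> ph n"
    from ec(1) consider J where "sufficient t1 J" "real J \<le> 192/100 * ph n1"
      | e m z where "sufficient_back t1 e m z" "e \<le> z" "real (2 * m + z) \<le> 15/10 * ph n1"
      unfolding economical_def n by blast
    then show ?thesis
    proof cases
      case 1
      have "real (J + 2 * J2 + 2 * J3 + 1) \<le> 192/100 * ph n"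
      proof (cases "n2 = 0")
        case True
        then show ?thesis using 1(2) J20 step by simp
      next
        case False
        have "192/100 * ph n1 + 4 * ph n2 + 4 * ph n3 \<le> 192/100 * ph n" using * pos by argo
        then show ?thesis using 1(2) J2 J3 False by simp
      qed
      then show ?thesis using std[OF 1(1)] by blast
    next
      case 2
      have "real (2 * (m + 2 * J2 + 2 * J3 + 1) + z) \<le> 15/10 * ph n"
      proof (cases "n2 = 0")
        case True
        then show ?thesis using 2(3) J20 step by simp
      next
        case False
        have "15/10 * ph n1 + 8 * ph n2 + 8 * ph n3 \<le> 15/10 * ph n" using * by argo
        then show ?thesis using 2(3) J2 J3 False by simp
      qed
      then show ?thesis using sufficient_back_path[OF 2(1) J(2,3), of r] 2(2) by blast
    qed
  qed
  from first obtain J where "sufficient (Nd r t1 t2 t3) J" "real J \<le> max 0 (2 * ph n - 1)" by auto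
  then show ?thesis using second unfolding economical_def n(1)[symmetric] by blast
qed

lemma economical: "economical t"
proof (induction t)
  case Lf
  then show ?case unfolding economical_def using sufficient_Lf[of 0]
    by (intro conjI disjI1 exI[of _ 0]) simp_all
next
  case (Nd r t1 t2 t3)
  note s = economical_Nd_sorted[where r = r]
  consider "size t3 \<le> size t2" "size t2 \<le> size t1" | "size t2 \<le> size t3" "size t3 \<le> size t1"
    | "size t3 \<le> size t1" "size t1 \<le> size t2" | "size t1 \<le> size t3" "size t3 \<le> size t2"
    | "size t2 \<le> size t1" "size t1 \<le> size t3" | "size t1 \<le> size t2" "size t2 \<le> size t3" by linarith
  then show ?case
  proof cases
    case 1
    then show ?thesis using s Nd.IH by blast
  next
    case 2
    then have "economical (Nd r t1 t3 t2)" using s Nd.IH by blast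
    then show ?thesis by (simp only: economical_swap(2)[of r t1 t3])
  next
    case 3
    then have "economical (Nd r t2 t1 t3)" using s Nd.IH by blast
    then show ?thesis by (simp only: economical_swap(1)[of r t2 t1])
  next
    case 4
    then have "economical (Nd r t2 t3 t1)" using s Nd.IH by blast
    then show ?thesis by (simp only: economical_swap(2)[of r t2 t3 t1] economical_swap(1)[of r t2 t1])
  next
    case 5
    then have "economical (Nd r t3 t1 t2)" using s Nd.IH by blast
    then show ?thesis by (simp only: economical_swap(1)[of r t3 t1] economical_swap(2)[of r t1 t3])
  next
    case 6
    then have "economical (Nd r t3 t2 t1)" using s Nd.IH by blast
    then show ?thesis
      by (simp only: economical_swap(1)[of r t3 t2] economical_swap(2)[of r t2 t3] economical_swap(1)[of r t2 t1])
  qed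
qed

lemma sufficient_size:
  assumes "2 * real (size t) powr 1.55 \<le> real N"
  shows "sufficient t N"
proof -
  obtain J where "sufficient t J" "real J \<le> max 0 (2 * ph (size t) - 1)"
    using economical unfolding economical_def by blast
  then show ?thesis using assms by (intro sufficient_mono[of t J N]) auto
qed

subsection \<open>From graphs to rooted trees and back\<close>

fun distinct_tr :: "'a tr \<Rightarrow> bool" where
  "distinct_tr Lf \<longleftrightarrow> True"
| "distinct_tr (Nd r t1 t2 t3) \<longleftrightarrow> r \<notin> set_tr t1 \<union> set_tr t2 \<union> set_tr t3 \<and>
     set_tr t1 \<inter> set_tr t2 = {} \<and> set_tr t1 \<inter> set_tr t3 = {} \<and> set_tr t2 \<inter> set_tr t3 = {} \<and>
     distinct_tr t1 \<and> distinct_tr t2 \<and> distinct_tr t3"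

fun tr_root :: "'a tr \<Rightarrow> 'a" where
  "tr_root (Nd r t1 t2 t3) = r"

text \<open>Edges are directed away from the root, starting with the one from the outer parent
  \<open>p\<close>. In a tree with distinct labels every vertex is then the head of exactly one
  pair, which matches the ownership of curves in \<open>hung\<close>.\<close>

fun hung_edges :: "'a \<Rightarrow> 'a tr \<Rightarrow> ('a \<times> 'a) set" where
  "hung_edges p Lf = {}"
| "hung_edges p (Nd r t1 t2 t3) = insert (p, r) (hung_edges r t1 \<union> hung_edges r t2 \<union> hung_edges r t3)"

fun tr_edges :: "'a tr \<Rightarrow> ('a \<times> 'a) set" where
  "tr_edges Lf = {}"
| "tr_edges (Nd r t1 t2 t3) = hung_edges r t1 \<union> hung_edges r t2 \<union> hung_edges r t3"

lemma hung_edges_subset: "hung_edges p t \<subseteq> insert p (set_tr t) \<times> set_tr t"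
  by (induction p t rule: hung_edges.induct) auto

lemma hung_edgesD: "(u, v) \<in> hung_edges p t \<Longrightarrow> (u = p \<or> u \<in> set_tr t) \<and> v \<in> set_tr t"
  using hung_edges_subset[of p t] by blast

lemma tr_edges_subset: "tr_edges t \<subseteq> hung_edges p t"
  by (cases t) auto

lemma hung_edges_parent_unique:
  "distinct_tr t \<Longrightarrow> (u, v) \<in> hung_edges p t \<Longrightarrow> (u', v) \<in> hung_edges p t \<Longrightarrow> u = u'"
proof (induction p t rule: hung_edges.induct)
  case (2 p r t1 t2 t3)
  then show ?case
    using hung_edgesD[of u v r t1] hung_edgesD[of u v r t2] hung_edgesD[of u v r t3]
      hung_edgesD[of u' v r t1] hung_edgesD[of u' v r t2] hung_edgesD[of u' v r t3]
    by (auto simp: disjoint_iff)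
qed simp

lemma hung_edges_asym:
  "distinct_tr t \<Longrightarrow> p \<notin> set_tr t \<Longrightarrow> (u, v) \<in> hung_edges p t \<Longrightarrow> (v, u) \<notin> hung_edges p t"
proof (induction p t rule: hung_edges.induct)
  case (2 p r t1 t2 t3)
  then show ?case
    using hung_edgesD[of u v r t1] hung_edgesD[of u v r t2] hung_edgesD[of u v r t3]
      hung_edgesD[of v u r t1] hung_edgesD[of v u r t2] hung_edgesD[of v u r t3]
    by (auto simp: disjoint_iff)
qed simp

lemma tr_edges_asym:
  "distinct_tr t \<Longrightarrow> (u, v) \<in> tr_edges t \<Longrightarrow> (v, u) \<notin> tr_edges t"
proof (cases t)
  case (Nd r t1 t2 t3)
  assume "distinct_tr t" "(u, v) \<in> tr_edges t"
  then show ?thesis unfolding Nd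
    using hung_edgesD[of u v r t1] hung_edgesD[of u v r t2] hung_edgesD[of u v r t3]
      hung_edgesD[of v u r t1] hung_edgesD[of v u r t2] hung_edgesD[of v u r t3]
      hung_edges_asym[of t1 r u v] hung_edges_asym[of t2 r u v] hung_edges_asym[of t3 r u v]
    by (auto simp: disjoint_iff)
qed simp

lemma tr_edges_parent_unique:
  "distinct_tr t \<Longrightarrow> (u, v) \<in> tr_edges t \<Longrightarrow> (u', v) \<in> tr_edges t \<Longrightarrow> u = u'"
  using hung_edges_parent_unique[of t u v undefined u'] tr_edges_subset by fastforce

lemma tr_edgesD: "distinct_tr t \<Longrightarrow> (u, v) \<in> tr_edges t \<Longrightarrow> u \<in> set_tr t \<and> v \<in> set_tr t \<and> v \<noteq> tr_root t \<and> u \<noteq> v"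
proof (cases t)
  case (Nd r t1 t2 t3)
  assume t: "distinct_tr t" "(u, v) \<in> tr_edges t"
  then have "u \<noteq> v" using tr_edges_asym by metis
  with t show ?thesis unfolding Nd using hung_edgesD[of u v r] by auto
qed simp

lemma has_parent: "v \<in> set_tr t \<Longrightarrow> \<exists>u. (u, v) \<in> hung_edges p t"
  by (induction p t rule: hung_edges.induct) auto

lemma has_tr_parent: "v \<in> set_tr t \<Longrightarrow> v \<noteq> tr_root t \<Longrightarrow> \<exists>u. (u, v) \<in> tr_edges t"
proof (cases t)
  case (Nd r t1 t2 t3)
  assume "v \<in> set_tr t" "v \<noteq> tr_root t"
  then show ?thesis unfolding Nd using has_parent[of v _ r] by auto
qed simp

lemma parent_reaches: "v \<in> set_tr t \<Longrightarrow> (p, v) \<in> (hung_edges p t)\<^sup>*"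
proof (induction p t rule: hung_edges.induct)
  case (2 p r t1 t2 t3)
  let ?R = "hung_edges p (Nd r t1 t2 t3)"
  have "(p, r) \<in> ?R\<^sup>*" by auto
  moreover have "(r, v) \<in> ?R\<^sup>*"
  proof -
    from 2 have "v = r \<or> (r, v) \<in> (hung_edges r t1)\<^sup>* \<or> (r, v) \<in> (hung_edges r t2)\<^sup>* \<or> (r, v) \<in> (hung_edges r t3)\<^sup>*"
      by auto
    moreover have "(hung_edges r t1)\<^sup>* \<subseteq> ?R\<^sup>*" "(hung_edges r t2)\<^sup>* \<subseteq> ?R\<^sup>*" "(hung_edges r t3)\<^sup>* \<subseteq> ?R\<^sup>*"
      by (rule rtrancl_mono; auto)+
    ultimately show ?thesis by blast
  qed
  ultimately show ?case by (rule rtrancl_trans)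
qed simp

lemma tr_root_reaches: "v \<in> set_tr t \<Longrightarrow> (tr_root t, v) \<in> (tr_edges t)\<^sup>*"
proof (cases t)
  case (Nd r t1 t2 t3)
  assume v: "v \<in> set_tr t"
  have "(hung_edges r t1)\<^sup>* \<subseteq> (tr_edges t)\<^sup>*" "(hung_edges r t2)\<^sup>* \<subseteq> (tr_edges t)\<^sup>*"
    "(hung_edges r t3)\<^sup>* \<subseteq> (tr_edges t)\<^sup>*"
    unfolding Nd by (rule rtrancl_mono; auto)+
  then show ?thesis
    using v parent_reaches[of v t1 r] parent_reaches[of v t2 r] parent_reaches[of v t3 r] unfolding Nd by auto
qed simp

text \<open>Either a slot below \<open>y\<close> is empty and receives \<open>x\<close>, or
  \<open>y\<close> already has three children. The claim on \<open>hung_edges\<close> is what the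
  induction carries, since the edges of a node consist of the edges of its children hung from
  it.\<close>

lemma tr_insert:
  assumes "y \<in> set_tr t" "distinct_tr t" "x \<notin> set_tr t"
  shows "(\<exists>t'. set_tr t' = insert x (set_tr t) \<and> distinct_tr t' \<and> t' \<noteq> Lf \<and> tr_root t' = tr_root t \<and>
       (\<forall>p. hung_edges p t' = insert (y, x) (hung_edges p t)) \<and> tr_edges t' = insert (y, x) (tr_edges t)) \<or>
    (\<exists>c1 c2 c3. distinct [c1, c2, c3] \<and> {(y, c1), (y, c2), (y, c3)} \<subseteq> tr_edges t)"
    (is "?ins t \<or> ?full t")
  using assms
proof (induction t)
  case (Nd r t1 t2 t3)
  let ?t = "Nd r t1 t2 t3"
  consider "y = r" | "y \<in> set_tr t1" | "y \<in> set_tr t2" | "y \<in> set_tr t3" using Nd.prems(1) by auto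
  then show ?case
  proof cases
    case 1
    consider "t1 = Lf" | "t2 = Lf" | "t3 = Lf" | "t1 \<noteq> Lf" "t2 \<noteq> Lf" "t3 \<noteq> Lf" by blast
    then show ?thesis
    proof cases
      case t1: 1
      have "?ins ?t" using Nd.prems 1 t1
        by (intro exI[of _ "Nd r (Nd x Lf Lf Lf) t2 t3"]) auto
      then show ?thesis by blast
    next
      case t2: 2
      have "?ins ?t" using Nd.prems 1 t2
        by (intro exI[of _ "Nd r t1 (Nd x Lf Lf Lf) t3"]) auto
      then show ?thesis by blast
    next
      case t3: 3
      have "?ins ?t" using Nd.prems 1 t3
        by (intro exI[of _ "Nd r t1 t2 (Nd x Lf Lf Lf)"]) auto
      then show ?thesis by blast
    next
      case full: 4
      obtain c1 a1 a2 a3 where t1: "t1 = Nd c1 a1 a2 a3" using full(1) by (cases t1) auto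
      obtain c2 b1 b2 b3 where t2: "t2 = Nd c2 b1 b2 b3" using full(2) by (cases t2) auto
      obtain c3 d1 d2 d3 where t3: "t3 = Nd c3 d1 d2 d3" using full(3) by (cases t3) auto
      have "distinct [c1, c2, c3]" using Nd.prems(2) unfolding t1 t2 t3 by auto
      then have "?full ?t" unfolding 1 t1 t2 t3
        by (intro exI[of _ c1] exI[of _ c2] exI[of _ c3]) simp
      then show ?thesis by blast
    qed
  next
    case 2
    then have "?ins t1 \<or> ?full t1" using Nd by auto
    then show ?thesis
    proof
      assume "?ins t1"
      then obtain t' where t': "set_tr t' = insert x (set_tr t1)" "distinct_tr t'"
        "\<forall>p. hung_edges p t' = insert (y, x) (hung_edges p t1)" by blast
      have "?ins ?t" using Nd.prems t' by (intro exI[of _ "Nd r t' t2 t3"]) auto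
      then show ?thesis by blast
    next
      assume "?full t1"
      then have "?full ?t" using tr_edges_subset[of t1 r] by (auto; blast)
      then show ?thesis by blast
    qed
  next
    case 3
    then have "?ins t2 \<or> ?full t2" using Nd by auto
    then show ?thesis
    proof
      assume "?ins t2"
      then obtain t' where t': "set_tr t' = insert x (set_tr t2)" "distinct_tr t'"
        "\<forall>p. hung_edges p t' = insert (y, x) (hung_edges p t2)" by blast
      have "?ins ?t" using Nd.prems t' by (intro exI[of _ "Nd r t1 t' t3"]) auto
      then show ?thesis by blast
    next
      assume "?full t2"
      then have "?full ?t" using tr_edges_subset[of t2 r] by (auto; blast)
      then show ?thesis by blast
    qed
  next
    case 4
    then have "?ins t3 \<or> ?full t3" using Nd by auto
    then show ?thesis
    proof
      assume "?ins t3"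
      then obtain t' where t': "set_tr t' = insert x (set_tr t3)" "distinct_tr t'"
        "\<forall>p. hung_edges p t' = insert (y, x) (hung_edges p t3)" by blast
      have "?ins ?t" using Nd.prems t' by (intro exI[of _ "Nd r t1 t2 t'"]) auto
      then show ?thesis by blast
    next
      assume "?full t3"
      then have "?full ?t" using tr_edges_subset[of t3 r] by (auto; blast)
      then show ?thesis by blast
    qed
  qed
qed simp

section \<open>Paths, leaves and rooted trees in graphs\<close>

lemma rtrancl_distinct_path:
  assumes "(a, b) \<in> R\<^sup>*"
  shows "\<exists>cs. cs \<noteq> [] \<and> distinct cs \<and> hd cs = a \<and> last cs = b \<and>
    (\<forall>i. Suc i < length cs \<longrightarrow> (cs ! i, cs ! Suc i) \<in> R)"
  using assms
proof (induction rule: rtrancl_induct)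
  case base
  show ?case by (rule exI[of _ "[a]"]) simp
next
  case (step y z)
  then obtain cs where cs: "cs \<noteq> []" "distinct cs" "hd cs = a" "last cs = y"
    "\<forall>i. Suc i < length cs \<longrightarrow> (cs ! i, cs ! Suc i) \<in> R" by blast
  show ?case
  proof (cases "z \<in> set cs")
    case True
    then obtain k where k: "k < length cs" "cs ! k = z" by (auto simp: in_set_conv_nth)
    \<comment> \<open>A path that returns to an earlier vertex is cut back to its first
      visit.\<close>
    let ?ds = "take (Suc k) cs"
    have "last ?ds = z" using k by (simp add: take_Suc_conv_app_nth)
    then show ?thesis using cs k by (intro exI[of _ ?ds]) (auto simp: hd_take)
  next
    case False
    have "(\<forall>i. Suc i < length (cs @ [z]) \<longrightarrow> ((cs @ [z]) ! i, (cs @ [z]) ! Suc i) \<in> R)"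
    proof (intro allI impI)
      fix i assume "Suc i < length (cs @ [z])"
      then consider "Suc i < length cs" | "Suc i = length cs" by force
      then show "((cs @ [z]) ! i, (cs @ [z]) ! Suc i) \<in> R"
      proof cases
        case 1
        then show ?thesis using cs(5) by (simp add: nth_append)
      next
        case 2
        then have "cs ! i = y" using cs(1,4) by (metis diff_Suc_1 last_conv_nth)
        then show ?thesis using 2 step(2) by (simp add: nth_append)
      qed
    qed
    then show ?thesis using cs False by (intro exI[of _ "cs @ [z]"]) auto
  qed
qed

lemma adj_sym: "adj E u v \<Longrightarrow> adj E v u"
  by (simp add: adj_def insert_commute)

lemma simple_graph_adj: "simple_graph V E \<Longrightarrow> adj E u v \<Longrightarrow> u \<in> V \<and> v \<in> V \<and> u \<noteq> v"
  unfolding simple_graph_def adj_def by (metis doubleton_eq_iff)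

lemma simple_graph_finite_edges: "simple_graph V E \<Longrightarrow> finite E"
proof -
  assume "simple_graph V E"
  then have "finite V" "E \<subseteq> Pow V" unfolding simple_graph_def by auto
  then show ?thesis by (meson finite_Pow_iff finite_subset)
qed

text \<open>If all degrees were at least 2, the end of a longest path would have a neighbour besides
  its predecessor; by maximality it lies on the path, and a cycle arises. The bound
  \<open><= 1\<close> instead of equality covers the tree with one vertex.\<close>

lemma tree_has_leaf:
  assumes "is_tree V E"
  shows "\<exists>r\<in>V. degree E r \<le> 1"
proof (rule ccontr)
  assume "\<not> ?thesis"
  then have deg: "degree E r \<ge> 2" if "r \<in> V" for r using that by force
  have g: "simple_graph V E" and fin: "finite V" and ne: "V \<noteq> {}" and nc: "\<not> has_cycle V E"
    using assms unfolding is_tree_def simple_graph_def by auto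
  define path where "path cs \<longleftrightarrow> cs \<noteq> [] \<and> distinct cs \<and> set cs \<subseteq> V \<and>
    (\<forall>i. Suc i < length cs \<longrightarrow> adj E (cs ! i) (cs ! Suc i))" for cs
  obtain v0 where "v0 \<in> V" using ne by blast
  then have "path [v0]" by (simp add: path_def)
  moreover have "length cs \<le> card V" if "path cs" for cs
    using that fin card_mono[of V "set cs"] distinct_card[of cs] unfolding path_def by simp
  ultimately have "\<exists>cs. path cs \<and> (\<forall>ds. path ds \<longrightarrow> length ds \<le> length cs)"
    by (intro ex_has_greatest_nat[of path "[v0]" length "Suc (card V)"]) (simp_all add: less_Suc_eq_le)
  then obtain cs where cs: "path cs" and max: "\<And>ds. path ds \<Longrightarrow> length ds \<le> length cs"
    by meson
  define x where "x = last cs"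
  have xV: "x \<in> V" and ncs: "cs \<noteq> []" using cs by (auto simp: path_def x_def)
  have dx: "2 \<le> card {e \<in> E. x \<in> e}" using deg[OF xV] by (simp add: degree_def)
  have finx: "finite {e \<in> E. x \<in> e}" using simple_graph_finite_edges[OF g] by simp
  \<comment> \<open>If the path has one vertex, truncated subtraction gives
    \<open>p = x\<close>.\<close>
  define p where "p = cs ! (length cs - 2)"
  have "\<exists>e\<in>{e \<in> E. x \<in> e}. e \<noteq> {p, x}"
  proof (rule ccontr)
    assume "\<not> ?thesis"
    then have "{e \<in> E. x \<in> e} \<subseteq> {{p, x}}" by blast
    then have "card {e \<in> E. x \<in> e} \<le> card {{p, x}}" by (intro card_mono) auto
    then show False using dx by simp
  qed
  then obtain e where e: "e \<in> E" "x \<in> e" "e \<noteq> {p, x}" by blast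
  then obtain z where z: "e = {x, z}" using g unfolding simple_graph_def by (metis insertE insert_commute singletonD)
  then have az: "adj E x z" "z \<noteq> p" using e by (auto simp: adj_def insert_commute)
  then have zV: "z \<in> V" "z \<noteq> x" using simple_graph_adj[OF g] by blast+
  have "z \<in> set cs"
  proof (rule ccontr)
    assume nz: "z \<notin> set cs"
    have "path (cs @ [z])" unfolding path_def
    proof (intro conjI allI impI)
      fix i assume "Suc i < length (cs @ [z])"
      then consider "Suc i < length cs" | "Suc i = length cs" by force
      then show "adj E ((cs @ [z]) ! i) ((cs @ [z]) ! Suc i)"
      proof cases
        case 1
        then show ?thesis using cs by (simp add: nth_append path_def)
      next
        case 2
        then have "cs ! i = x" using ncs by (metis diff_Suc_1 last_conv_nth x_def)
        then show ?thesis using 2 az by (simp add: nth_append)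
      qed
    qed (use cs nz zV in \<open>auto simp: path_def\<close>)
    then show False using max by fastforce
  qed
  then obtain k where k: "k < length cs" "cs ! k = z" by (auto simp: in_set_conv_nth)
  have "k \<noteq> length cs - 1" using k zV(2) ncs by (auto simp: x_def last_conv_nth)
  moreover have "k \<noteq> length cs - 2" using k az(2) by (auto simp: p_def)
  ultimately have len: "3 \<le> length (drop k cs)" using k(1) by simp
  have "has_cycle V E" unfolding has_cycle_def
  proof (intro exI[of _ "drop k cs"] conjI allI impI)
    show "set (drop k cs) \<subseteq> V" using cs set_drop_subset[of k cs] unfolding path_def by blast
    show "adj E (last (drop k cs)) (hd (drop k cs))"
      using k az(1) by (simp add: last_drop x_def[symmetric] hd_drop_conv_nth)
    show "adj E (drop k cs ! i) (drop k cs ! Suc i)" if "Suc i < length (drop k cs)" for i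
      using cs that unfolding path_def by simp
  qed (use len cs in \<open>auto simp: path_def\<close>)
  with nc show False by blast
qed

text \<open>Take a largest ternary tree inside the graph with a leaf as root. If some neighbour
  \<open>x\<close> of \<open>y\<close> is missing, \<open>y\<close> already has three children,
  hence four neighbours with \<open>x\<close>. This is too many for the root, and for any other
  vertex the parent is a fifth. So the tree is closed under adjacency, and by connectedness it
  contains all vertices.\<close>

lemma tree_as_tr:
  assumes tree: "is_tree V E" and deg: "max_degree_le V E 4"
  shows "\<exists>t. distinct_tr t \<and> t \<noteq> Lf \<and> set_tr t = V \<and> E = (\<lambda>(u, v). {u, v}) ` tr_edges t"
proof -
  have g: "simple_graph V E" and fin: "finite V" and conn: "graph_connected V E" and nc: "\<not> has_cycle V E"
    using tree unfolding is_tree_def simple_graph_def by auto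
  have finE: "finite E" by (rule simple_graph_finite_edges[OF g])
  obtain r where r: "r \<in> V" "degree E r \<le> 1" using tree_has_leaf[OF tree] by blast
  define emb where "emb t \<longleftrightarrow> distinct_tr t \<and> t \<noteq> Lf \<and> tr_root t = r \<and> set_tr t \<subseteq> V \<and>
    (\<forall>(u, v)\<in>tr_edges t. adj E u v)" for t
  have "emb (Nd r Lf Lf Lf)" using r by (simp add: emb_def)
  moreover have "card (set_tr t) \<le> card V" if "emb t" for t
    using that fin unfolding emb_def by (auto intro: card_mono)
  ultimately have "\<exists>t. emb t \<and> (\<forall>t'. emb t' \<longrightarrow> card (set_tr t') \<le> card (set_tr t))"
    by (intro ex_has_greatest_nat[of emb "Nd r Lf Lf Lf" "\<lambda>t. card (set_tr t)" "Suc (card V)"]) (simp_all add: less_Suc_eq_le)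
  then obtain t where t: "emb t" and max: "\<And>t'. emb t' \<Longrightarrow> card (set_tr t') \<le> card (set_tr t)"
    by meson
  have d: "distinct_tr t" "t \<noteq> Lf" "tr_root t = r" "set_tr t \<subseteq> V" and te: "\<And>u v. (u, v) \<in> tr_edges t \<Longrightarrow> adj E u v"
    using t unfolding emb_def by auto
  have rt: "r \<in> set_tr t" using d by (cases t) auto
  have closed: "x \<in> set_tr t" if y: "y \<in> set_tr t" and a: "adj E y x" for x y
  proof (rule ccontr)
    assume x: "x \<notin> set_tr t"
    have yV: "y \<in> V" "x \<in> V" using simple_graph_adj[OF g a] by auto
    from tr_insert[OF y d(1) x] show False
    proof (elim disjE exE conjE)
      fix t' assume t': "set_tr t' = insert x (set_tr t)" "distinct_tr t'" "t' \<noteq> Lf" "tr_root t' = tr_root t"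
        "tr_edges t' = insert (y, x) (tr_edges t)"
      have "emb t'" using t' d te a yV unfolding emb_def by auto
      moreover have "card (set_tr t') = card (set_tr t) + 1"
        using t'(1) x finite_subset[OF d(4) fin] by simp
      ultimately show False using max by fastforce
    next
      fix c1 c2 c3 assume c: "distinct [c1, c2, c3]" "{(y, c1), (y, c2), (y, c3)} \<subseteq> tr_edges t"
      have cm: "c1 \<in> set_tr t" "c2 \<in> set_tr t" "c3 \<in> set_tr t" using c(2) tr_edgesD[OF d(1)] by blast+
      let ?N = "{{y, x}, {y, c1}, {y, c2}, {y, c3}}"
      have N: "?N \<subseteq> {e \<in> E. y \<in> e}" using c te a by (auto simp: adj_def)
      have cN: "card ?N = 4" using c(1) cm x by (auto simp: card_insert_if doubleton_eq_iff)
      have "4 \<le> degree E y"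
        unfolding degree_def cN[symmetric] by (rule card_mono) (use finE N in auto)
      then have "y \<noteq> r" using r by auto
      then obtain u where u: "(u, y) \<in> tr_edges t" using has_tr_parent[OF y] d(3) by blast
      have "u \<noteq> c1" "u \<noteq> c2" "u \<noteq> c3" using tr_edges_asym[OF d(1) u] c(2) by auto
      moreover have "u \<noteq> x" using tr_edgesD[OF d(1) u] x by blast
      ultimately have "{u, y} \<notin> ?N" by (auto simp: doubleton_eq_iff)
      then have c5: "card (insert {u, y} ?N) = 5" using cN by simp
      have "insert {u, y} ?N \<subseteq> {e \<in> E. y \<in> e}" using N te[OF u] by (auto simp: adj_def)
      then have "5 \<le> degree E y"
        unfolding degree_def c5[symmetric] by (intro card_mono) (use finE in simp)
      moreover have "degree E y \<le> 4" using deg yV unfolding max_degree_le_def by blast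
      ultimately show False by simp
    qed
  qed
  have V: "set_tr t = V"
  proof
    show "V \<subseteq> set_tr t"
    proof
      fix v assume "v \<in> V"
      then have "(r, v) \<in> {(x, y). adj E x y}\<^sup>*" using conn r(1) unfolding graph_connected_def by blast
      then show "v \<in> set_tr t" by induction (use rt closed in auto)
    qed
  qed (rule d(4))
  define R where "R = tr_edges t \<union> (tr_edges t)\<inverse>"
  have RE: "adj E u v" if "(u, v) \<in> R" for u v using that te adj_sym unfolding R_def by fastforce
  have Rs: "(u, v) \<in> R\<^sup>*" if "u \<in> V" "v \<in> V" for u v
  proof -
    have *: "(tr_root t, v) \<in> (tr_edges t)\<^sup>*" "(tr_root t, u) \<in> (tr_edges t)\<^sup>*"
      using tr_root_reaches that V by auto
    have "(u, tr_root t) \<in> ((tr_edges t)\<inverse>)\<^sup>*" using *(2) by (simp add: rtrancl_converse)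
    then have "(u, tr_root t) \<in> R\<^sup>*" by (rule rtrancl_mono[THEN subsetD, rotated]) (simp add: R_def)
    moreover from *(1) have "(tr_root t, v) \<in> R\<^sup>*"
      by (rule rtrancl_mono[THEN subsetD, rotated]) (simp add: R_def)
    ultimately show ?thesis by (rule rtrancl_trans)
  qed
  have sub: "(\<lambda>(u, v). {u, v}) ` tr_edges t \<subseteq> E" using te by (auto simp: adj_def)
  \<comment> \<open>An edge of the graph missing from the rooted tree would close the tree path
    between its ends to a cycle.\<close>
  have "E \<subseteq> (\<lambda>(u, v). {u, v}) ` tr_edges t"
  proof (rule ccontr)
    assume "\<not> ?thesis"
    then obtain e where e: "e \<in> E" "e \<notin> (\<lambda>(u, v). {u, v}) ` tr_edges t" by blast
    then obtain u v where uv: "u \<in> V" "v \<in> V" "u \<noteq> v" "e = {u, v}"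
      using g unfolding simple_graph_def by blast
    have "(u, v) \<notin> tr_edges t"
    proof
      assume "(u, v) \<in> tr_edges t"
      then have "{u, v} \<in> (\<lambda>(u, v). {u, v}) ` tr_edges t" by (intro image_eqI[of _ _ "(u, v)"]) auto
      then show False using e uv by simp
    qed
    moreover have "(v, u) \<notin> tr_edges t"
    proof
      assume "(v, u) \<in> tr_edges t"
      then have "{u, v} \<in> (\<lambda>(u, v). {u, v}) ` tr_edges t"
        by (intro image_eqI[of _ _ "(v, u)"]) (auto simp: insert_commute)
      then show False using e uv by simp
    qed
    ultimately have nR: "(u, v) \<notin> R" by (simp add: R_def)
    obtain cs where cs: "cs \<noteq> []" "distinct cs" "hd cs = u" "last cs = v"
      "\<forall>i. Suc i < length cs \<longrightarrow> (cs ! i, cs ! Suc i) \<in> R"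
      using rtrancl_distinct_path[OF Rs[OF uv(1,2)]] by blast
    have l1: "length cs \<noteq> 1"
    proof
      assume "length cs = 1"
      then obtain x where "cs = [x]" by (auto simp: length_Suc_conv)
      then show False using cs(3,4) uv(3) by simp
    qed
    have l2: "length cs \<noteq> 2"
    proof
      assume "length cs = 2"
      then obtain x y where "cs = [x, y]" by (auto simp: length_Suc_conv numeral_2_eq_2)
      then show False using cs(3-5) nR by auto
    qed
    have "length cs \<noteq> 0" using cs(1) by simp
    then have len: "3 \<le> length cs" using l1 l2 by linarith
    have "has_cycle V E" unfolding has_cycle_def
    proof (intro exI[of _ cs] conjI allI impI)
      show "set cs \<subseteq> V"
      proof
        fix x assume "x \<in> set cs"
        then obtain i where i: "i < length cs" "cs ! i = x" by (auto simp: in_set_conv_nth)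
        show "x \<in> V"
        proof (cases "Suc i < length cs")
          case True
          then show ?thesis using cs(5) RE simple_graph_adj[OF g] i(2) by blast
        next
          case False
          then have "i = length cs - 1" using i(1) by simp
          then have "x = v" using i(2) cs(1,4) by (simp add: last_conv_nth)
          then show ?thesis using uv by simp
        qed
      qed
      show "adj E (last cs) (hd cs)" using e(1) uv(4) cs(3,4) by (simp add: adj_def insert_commute)
    qed (use len cs RE in auto)
    with nc show False by blast
  qed
  then show ?thesis using sub V d by blast
qed

section \<open>From hung trees to placements and bends\<close>

text \<open>The witnesses hidden in \<open>hung\<close> are collected into functions. Bends and
  owned sets are indexed by the child of an edge; the outer parent \<open>p\<close> only has a
  position, \<open>w\<close>.\<close>

definition realizes ::
    "('a \<times> 'a) set \<Rightarrow> 'a \<Rightarrow> 'a set \<Rightarrow> point \<Rightarrow> point set \<Rightarrow> point set \<Rightarrow>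
      ('a \<Rightarrow> point) \<Rightarrow> ('a \<Rightarrow> point) \<Rightarrow> ('a \<Rightarrow> point set) \<Rightarrow> bool" where
  "realizes R p X w P Q f g own \<longleftrightarrow> f p = w \<and>
     (\<forall>v\<in>X. f v \<in> P \<and> f v \<in> own v \<and> own v \<subseteq> Q) \<and>
     (\<forall>u\<in>X. \<forall>v\<in>X. u \<noteq> v \<longrightarrow> own u \<inter> own v = {}) \<and>
     (\<forall>(u, v)\<in>R. g v \<in> corners (f u) (f v) \<and> own v = L_curve (f u) (g v) (f v) - {f u})"

lemma realizesD:
  assumes "realizes R p X w P Q f g own"
  shows "f p = w" "\<And>v. v \<in> X \<Longrightarrow> f v \<in> P \<and> f v \<in> own v \<and> own v \<subseteq> Q"
    "\<And>u v. u \<in> X \<Longrightarrow> v \<in> X \<Longrightarrow> u \<noteq> v \<Longrightarrow> own u \<inter> own v = {}"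
    "\<And>u v. (u, v) \<in> R \<Longrightarrow> g v \<in> corners (f u) (f v) \<and> own v = L_curve (f u) (g v) (f v) - {f u}"
  using assms unfolding realizes_def by auto

definition realized :: "('a \<times> 'a) set \<Rightarrow> 'a \<Rightarrow> 'a set \<Rightarrow> point \<Rightarrow> point set \<Rightarrow> point set \<Rightarrow> bool" where
  "realized R p X w P Q \<longleftrightarrow> (\<exists>f g own. realizes R p X w P Q f g own)"

text \<open>The functions are glued along the disjoint sets \<open>X1\<close> and \<open>X2\<close>.
  Both place the common parent \<open>p\<close> at \<open>w\<close>, so edges leaving
  \<open>p\<close> are unaffected.\<close>

lemma realized_Un:
  assumes 1: "realized R1 p X1 w P Q1" and 2: "realized R2 p X2 w P Q2"
    and R: "R1 \<subseteq> insert p X1 \<times> X1" "R2 \<subseteq> insert p X2 \<times> X2"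
    and X: "X1 \<inter> X2 = {}" "p \<notin> X1" "p \<notin> X2" and Q: "Q1 \<inter> Q2 = {}"
  shows "realized (R1 \<union> R2) p (X1 \<union> X2) w P (Q1 \<union> Q2)"
proof -
  obtain f1 g1 o1 where r1: "realizes R1 p X1 w P Q1 f1 g1 o1"
    using 1 unfolding realized_def by blast
  obtain f2 g2 o2 where r2: "realizes R2 p X2 w P Q2 f2 g2 o2"
    using 2 unfolding realized_def by blast
  note 1 = realizesD[OF r1]
  note 2 = realizesD[OF r2]
  define f where "f v = (if v \<in> X1 then f1 v else f2 v)" for v
  define g where "g v = (if v \<in> X1 then g1 v else g2 v)" for v
  define own where "own v = (if v \<in> X1 then o1 v else o2 v)" for v
  have f: "f p = w" "\<And>v. v \<in> insert p X1 \<Longrightarrow> f v = f1 v" "\<And>v. v \<in> insert p X2 \<Longrightarrow> f v = f2 v"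
    using X 1(1) 2(1) by (auto simp: f_def)
  have go: "\<And>v. v \<in> X1 \<Longrightarrow> g v = g1 v \<and> own v = o1 v" "\<And>v. v \<in> X2 \<Longrightarrow> g v = g2 v \<and> own v = o2 v"
    using X by (auto simp: g_def own_def)
  show ?thesis unfolding realized_def realizes_def
  proof (intro exI conjI ballI impI)
    show "f p = w" by (rule f)
    fix v assume "v \<in> X1 \<union> X2"
    then show "f v \<in> P" "f v \<in> own v" "own v \<subseteq> Q1 \<union> Q2"
      using 1(2)[of v] 2(2)[of v] f(2,3)[of v] go[of v] by auto
  next
    fix u v assume uv: "u \<in> X1 \<union> X2" "v \<in> X1 \<union> X2" "u \<noteq> v"
    then consider "u \<in> X1" "v \<in> X1" | "u \<in> X2" "v \<in> X2" | "u \<in> X1" "v \<in> X2" | "u \<in> X2" "v \<in> X1" by blast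
    then show "own u \<inter> own v = {}"
    proof cases
      case a: 1
      then show ?thesis using 1(3)[OF a uv(3)] go(1)[of u] go(1)[of v] by simp
    next
      case a: 2
      then show ?thesis using 2(3)[OF a uv(3)] go(2)[of u] go(2)[of v] by simp
    next
      case a: 3
      then show ?thesis using 1(2)[OF a(1)] 2(2)[OF a(2)] go(1)[OF a(1)] go(2)[OF a(2)] Q by auto
    next
      case a: 4
      then show ?thesis using 1(2)[OF a(2)] 2(2)[OF a(1)] go(1)[OF a(2)] go(2)[OF a(1)] Q by auto
    qed
  next
    fix e assume e: "e \<in> R1 \<union> R2"
    show "case e of (u, v) \<Rightarrow> g v \<in> corners (f u) (f v) \<and> own v = L_curve (f u) (g v) (f v) - {f u}"
    proof (cases e)
      case (Pair u v)
      from e Pair consider "(u, v) \<in> R1" | "(u, v) \<in> R2" by blast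
      then show ?thesis
      proof cases
        case a: 1
        then have "u \<in> insert p X1" "v \<in> X1" using R by auto
        then show ?thesis using 1(4)[OF a] f(2)[of u] f(2)[of v] go(1)[of v] Pair by simp
      next
        case a: 2
        then have "u \<in> insert p X2" "v \<in> X2" using R by auto
        then show ?thesis using 2(4)[OF a] f(3)[of u] f(3)[of v] go(2)[of v] Pair by simp
      qed
    qed
  qed
qed

lemma realized_three:
  assumes "realized (hung_edges r t1) r (set_tr t1) w P Q1" "realized (hung_edges r t2) r (set_tr t2) w P Q2"
    "realized (hung_edges r t3) r (set_tr t3) w P Q3"
    and "distinct_tr (Nd r t1 t2 t3)" "Q1 \<inter> Q2 = {}" "Q1 \<inter> Q3 = {}" "Q2 \<inter> Q3 = {}"
  shows "realized (tr_edges (Nd r t1 t2 t3)) r (set_tr t1 \<union> set_tr t2 \<union> set_tr t3) w P (Q1 \<union> Q2 \<union> Q3)"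
proof -
  have 12: "realized (hung_edges r t1 \<union> hung_edges r t2) r (set_tr t1 \<union> set_tr t2) w P (Q1 \<union> Q2)"
    by (rule realized_Un[OF assms(1,2) hung_edges_subset hung_edges_subset]) (use assms in auto)
  have "hung_edges r t1 \<union> hung_edges r t2 \<subseteq> insert r (set_tr t1 \<union> set_tr t2) \<times> (set_tr t1 \<union> set_tr t2)"
    using hung_edges_subset[of r t1] hung_edges_subset[of r t2] by blast
  from realized_Un[OF 12 assms(3) this hung_edges_subset] show ?thesis
    using assms by (auto simp: Int_Un_distrib2)
qed

lemma realized_hung:
  "hung t w P Q \<Longrightarrow> distinct_tr t \<Longrightarrow> p \<notin> set_tr t \<Longrightarrow> realized (hung_edges p t) p (set_tr t) w P Q"
proof (induction t arbitrary: p w Q)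
  case Lf
  then show ?case unfolding realized_def realizes_def by (intro exI[of _ "\<lambda>_. w"]) simp
next
  case (Nd r t1 t2 t3)
  from Nd.prems(1) obtain x k Q1 Q2 Q3 where
    *: "x \<in> P" "x \<noteq> w" "k \<in> corners w x" "hung t1 x P Q1" "hung t2 x P Q2" "hung t3 x P Q3"
     "Q = (L_curve w k x - {w}) \<union> Q1 \<union> Q2 \<union> Q3"
     "(L_curve w k x - {w}) \<inter> (Q1 \<union> Q2 \<union> Q3) = {}" "Q1 \<inter> Q2 = {}" "Q1 \<inter> Q3 = {}" "Q2 \<inter> Q3 = {}"
    unfolding hung.simps by metis
  let ?X = "set_tr t1 \<union> set_tr t2 \<union> set_tr t3" and ?E = "tr_edges (Nd r t1 t2 t3)"
  have real: "realized ?E r ?X x P (Q1 \<union> Q2 \<union> Q3)"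
    by (rule realized_three) (use Nd * in auto)
  obtain f g own where real': "realizes ?E r ?X x P (Q1 \<union> Q2 \<union> Q3) f g own"
    using real unfolding realized_def by blast
  note f = realizesD[OF real']
  have r: "r \<notin> ?X" "p \<noteq> r" "p \<notin> ?X" using Nd.prems by auto
  let ?f = "f(p := w)" and ?g = "g(r := k)" and ?own = "own(r := L_curve w k x - {w})"
  have xL: "x \<in> L_curve w k x" by (simp add: L_curve_def)
  show ?case unfolding realized_def realizes_def
  proof (rule exI[of _ ?f], rule exI[of _ ?g], rule exI[of _ ?own], intro conjI ballI impI)
    fix v assume "v \<in> set_tr (Nd r t1 t2 t3)"
    then have "v = r \<or> v \<in> ?X" by auto
    then show "?f v \<in> P" "?f v \<in> ?own v" "?own v \<subseteq> Q"
      using f(1) f(2)[of v] * xL r by (auto simp: fun_upd_def)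
  next
    fix u v assume uv: "u \<in> set_tr (Nd r t1 t2 t3)" "v \<in> set_tr (Nd r t1 t2 t3)" "u \<noteq> v"
    then consider "u \<in> ?X" "v \<in> ?X" | "u = r" "v \<in> ?X" | "v = r" "u \<in> ?X" by auto
    then show "?own u \<inter> ?own v = {}"
    proof cases
      case 1
      then have "u \<noteq> r" "v \<noteq> r" using r(1) by blast+
      then show ?thesis using f(3)[OF 1 uv(3)] by simp
    next
      case 2
      then have "v \<noteq> r" using r(1) by blast
      then show ?thesis using f(2)[OF 2(2)] *(8) 2(1) by (simp add: disjoint_iff) blast
    next
      case 3
      then have "u \<noteq> r" using r(1) by blast
      then show ?thesis using f(2)[OF 3(2)] *(8) 3(1) by (simp add: disjoint_iff) blast
    qed
  next
    fix e assume "e \<in> hung_edges p (Nd r t1 t2 t3)"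
    then have "e = (p, r) \<or> e \<in> ?E" by simp
    then show "case e of (u, v) \<Rightarrow> ?g v \<in> corners (?f u) (?f v) \<and> ?own v = L_curve (?f u) (?g v) (?f v) - {?f u}"
    proof
      assume "e = (p, r)"
      then show ?thesis using * f(1) r by simp
    next
      assume e: "e \<in> ?E"
      obtain u v where uv: "e = (u, v)" by (cases e)
      have D: "u \<in> set_tr (Nd r t1 t2 t3) \<and> v \<in> set_tr (Nd r t1 t2 t3) \<and> v \<noteq> tr_root (Nd r t1 t2 t3) \<and> u \<noteq> v"
        by (rule tr_edgesD[OF Nd.prems(2)]) (use e uv in simp)
      then have "u \<noteq> p" "v \<noteq> p" using Nd.prems(3) by blast+
      moreover have "v \<noteq> r" using D by simp
      ultimately show ?thesis using f(4)[of u v] e uv by simp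
    qed
  qed simp
qed

lemma L_curve_commute: "L_curve p k q = L_curve q k p"
  unfolding L_curve_def by (simp add: closed_segment_commute Un_commute)

text \<open>An edge curve is the point of the parent together with part of the set owned by the
  child. Distinct edges have distinct children, since parents are unique, so disjointness of owned
  sets leaves only common endpoints. The auxiliary edge from \<open>w\<close> is dropped, and the
  root owns just its point.\<close>

lemma drawing_of_hung:
  assumes h: "hung t w P Q" and d: "distinct_tr t" and ne: "t \<noteq> Lf"
  shows "has_planar_L_drawing (set_tr t) ((\<lambda>(u, v). {u, v}) ` tr_edges t) P"
proof (cases t)
  case (Nd r t1 t2 t3)
  from h obtain x k Q1 Q2 Q3 where
    *: "x \<in> P" "x \<noteq> w" "hung t1 x P Q1" "hung t2 x P Q2" "hung t3 x P Q3"
     "(L_curve w k x - {w}) \<inter> (Q1 \<union> Q2 \<union> Q3) = {}" "Q1 \<inter> Q2 = {}" "Q1 \<inter> Q3 = {}" "Q2 \<inter> Q3 = {}"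
    unfolding Nd hung.simps by metis
  let ?X = "set_tr t1 \<union> set_tr t2 \<union> set_tr t3" and ?R = "tr_edges t" and ?V = "set_tr t"
  have X: "?V = insert r ?X" "r \<notin> ?X" using d unfolding Nd by auto
  have real: "realized ?R r ?X x P (Q1 \<union> Q2 \<union> Q3)"
    unfolding Nd
  proof (rule realized_three)
    show "realized (hung_edges r t1) r (set_tr t1) x P Q1" by (rule realized_hung[OF *(3)]) (use d Nd in auto)
    show "realized (hung_edges r t2) r (set_tr t2) x P Q2" by (rule realized_hung[OF *(4)]) (use d Nd in auto)
    show "realized (hung_edges r t3) r (set_tr t3) x P Q3" by (rule realized_hung[OF *(5)]) (use d Nd in auto)
  qed (use * d Nd in auto)
  obtain f g own0 where real': "realizes ?R r ?X x P (Q1 \<union> Q2 \<union> Q3) f g own0"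
    using real unfolding realized_def by blast
  note f = realizesD[OF real']
  define own where "own = own0(r := {x})"
  have xL: "x \<in> L_curve w k x - {w}" using *(2) by (simp add: L_curve_def)
  then have xQ: "x \<notin> Q1 \<union> Q2 \<union> Q3" using *(6) by blast
  have fV: "f v \<in> P \<and> f v \<in> own v" if "v \<in> ?V" for v
    using that f(1,2) *(1) X by (auto simp: own_def)
  have disj: "u = v" if "u \<in> ?V" "v \<in> ?V" "q \<in> own u" "q \<in> own v" for u v q
  proof (rule ccontr)
    assume "u \<noteq> v"
    have "u = r \<or> u \<in> ?X" "v = r \<or> v \<in> ?X" using that(1,2) unfolding X(1) by simp_all
    with \<open>u \<noteq> v\<close> consider "u \<in> ?X" "v \<in> ?X" | "u = r" "v \<in> ?X" | "v = r" "u \<in> ?X" by argo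
    then show False
    proof cases
      case 1
      then have "u \<noteq> r" "v \<noteq> r" using X(2) by blast+
      then show False using f(3)[OF 1 \<open>u \<noteq> v\<close>] that(3,4) by (auto simp: own_def)
    next
      case 2
      then have "v \<noteq> r" using X(2) by blast
      then show False using f(2)[OF 2(2)] that(3,4) 2(1) xQ by (auto simp: own_def)
    next
      case 3
      then have "u \<noteq> r" using X(2) by blast
      then show False using f(2)[OF 3(2)] that(3,4) 3(1) xQ by (auto simp: own_def)
    qed
  qed
  have R: "u \<in> ?V \<and> v \<in> ?V \<and> u \<noteq> v \<and> g v \<in> corners (f u) (f v) \<and> L_curve (f u) (g v) (f v) \<subseteq> insert (f u) (own v)"
    if "(u, v) \<in> ?R" for u v
  proof -
    have "u \<in> ?V" "v \<in> ?V" "v \<noteq> r" "u \<noteq> v" using tr_edgesD[OF d that] by (auto simp: Nd)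
    then show ?thesis using f(4)[OF that] by (auto simp: own_def)
  qed
  \<comment> \<open>Orients an undirected edge from parent to child, so that the bend stored at the
    child can be assigned to the edge.\<close>
  define pc where "pc e = (SOME q. q \<in> ?R \<and> e = {fst q, snd q})" for e
  define E where "E = (\<lambda>(u, v). {u, v}) ` ?R"
  define bend where "bend e = g (snd (pc e))" for e
  have pc: "\<exists>u v. pc e = (u, v) \<and> (u, v) \<in> ?R \<and> e = {u, v}" if "e \<in> E" for e
  proof -
    have "\<exists>q. q \<in> ?R \<and> e = {fst q, snd q}" using that unfolding E_def by auto
    then have "pc e \<in> ?R \<and> e = {fst (pc e), snd (pc e)}" unfolding pc_def by (rule someI_ex)
    then show ?thesis by (cases "pc e") auto
  qed
  have curve: "edge_curve f bend e \<subseteq> insert (f u) (own v)" if "pc e = (u, v)" "(u, v) \<in> ?R" "e = {u, v}" for e u v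
  proof
    fix q assume "q \<in> edge_curve f bend e"
    then obtain a b where ab: "e = {a, b}" "q \<in> L_curve (f a) (bend e) (f b)" unfolding edge_curve_def by blast
    have be: "bend e = g v" using that(1) by (simp add: bend_def)
    from ab(1) that(3) have "a = u \<and> b = v \<or> a = v \<and> b = u" by (simp add: doubleton_eq_iff) blast
    then have "q \<in> L_curve (f u) (g v) (f v)" using ab(2) be L_curve_commute[of "f v" "g v" "f u"] by auto
    then show "q \<in> insert (f u) (own v)" using R[OF that(2)] by blast
  qed
  have "planar_L_drawing ?V E P f bend" unfolding planar_L_drawing_def
  proof (intro conjI ballI impI)
    show "inj_on f ?V"
    proof (rule inj_onI)
      fix u v assume "u \<in> ?V" "v \<in> ?V" "f u = f v"
      then show "u = v" using fV[of u] fV[of v] by (intro disj[of u v "f u"]) auto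
    qed
    show "f ` ?V \<subseteq> P" using fV by blast
  next
    fix e assume "e \<in> E"
    then obtain u v where e: "pc e = (u, v)" "(u, v) \<in> ?R" "e = {u, v}" using pc by blast
    show "\<exists>u v. e = {u, v} \<and> bend e \<in> {(fst (f u), snd (f v)), (fst (f v), snd (f u))}"
      using e R[OF e(2)] by (intro exI[of _ u] exI[of _ v]) (simp add: bend_def corners_def)
    show "edge_curve f bend e \<inter> f ` ?V \<subseteq> f ` e"
    proof
      fix q assume q: "q \<in> edge_curve f bend e \<inter> f ` ?V"
      then obtain y where y: "y \<in> ?V" "q = f y" by blast
      from q curve[OF e] have "q = f u \<or> q \<in> own v" by blast
      then show "q \<in> f ` e"
      proof
        assume "q \<in> own v"
        then have "y = v" using y fV[of y] R[OF e(2)] by (intro disj[of y v q]) auto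
        then show ?thesis using y e(3) by blast
      qed (use e(3) in blast)
    qed
  next
    fix e1 e2 assume "e1 \<in> E" "e2 \<in> E" and ne: "e1 \<noteq> e2"
    then obtain u1 v1 u2 v2 where e1: "pc e1 = (u1, v1)" "(u1, v1) \<in> ?R" "e1 = {u1, v1}"
      and e2: "pc e2 = (u2, v2)" "(u2, v2) \<in> ?R" "e2 = {u2, v2}" using pc by meson
    have V: "u1 \<in> ?V" "v1 \<in> ?V" "u2 \<in> ?V" "v2 \<in> ?V" using R[OF e1(2)] R[OF e2(2)] by auto
    have v12: "v1 \<noteq> v2" using tr_edges_parent_unique[OF d e1(2)] e2 e1 ne by blast
    show "edge_curve f bend e1 \<inter> edge_curve f bend e2 \<subseteq> f ` (e1 \<inter> e2)"
    proof
      fix q assume q: "q \<in> edge_curve f bend e1 \<inter> edge_curve f bend e2"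
      then have "q = f u1 \<or> q \<in> own v1" "q = f u2 \<or> q \<in> own v2" using curve[OF e1] curve[OF e2] by blast+
      then consider "q = f u1" "q = f u2" | "q = f u1" "q \<in> own v2" | "q \<in> own v1" "q = f u2" | "q \<in> own v1" "q \<in> own v2"
        by blast
      then show "q \<in> f ` (e1 \<inter> e2)"
      proof cases
        case 1
        then have "u1 = u2" using fV[OF V(1)] fV[OF V(3)] by (intro disj[OF V(1,3), of q]) auto
        then show ?thesis using 1 e1(3) e2(3) by blast
      next
        case 2
        then have "u1 = v2" using fV[OF V(1)] by (intro disj[OF V(1,4), of q]) auto
        then show ?thesis using 2 e1(3) e2(3) by blast
      next
        case 3
        then have "u2 = v1" using fV[OF V(3)] by (intro disj[OF V(3,2), of q]) auto
        then show ?thesis using 3 e1(3) e2(3) by blast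
      next
        case 4
        then show ?thesis using disj[OF V(2,4)] v12 by blast
      qed
    qed
  qed
  then show ?thesis unfolding has_planar_L_drawing_def E_def by blast
qed (use ne in simp)

subsection \<open>Points in general position suffice for every tree\<close>

lemma size_distinct_tr:
  fixes t :: "'a tr"
  shows "distinct_tr t \<Longrightarrow> size t = card (set_tr t)"
proof (induction t)
  case (Nd r t1 t2 t3)
  let ?X = "set_tr t1 \<union> set_tr t2 \<union> set_tr t3"
  have fin: "finite (set_tr t)" for t :: "'a tr" by (induction t) auto
  then have "card ?X = card (set_tr t1) + card (set_tr t2) + card (set_tr t3)"
    using Nd.prems by (simp add: card_Un_disjoint Int_Un_distrib2)
  moreover have "card (insert r ?X) = card ?X + 1"
    using Nd.prems fin by simp
  ultimately show ?case using Nd by simp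
qed simp

lemma finite_points_in_box:
  assumes "finite P"
  obtains B :: real where "0 < B" "\<forall>p\<in>P. inbox (- B) B (- B) B p"
proof -
  have "bounded P" by (rule finite_imp_bounded[OF assms])
  then obtain B where B: "0 < B" "\<forall>p\<in>P. norm p \<le> B" by (auto simp: bounded_pos)
  have "inbox (- (B + 1)) (B + 1) (- (B + 1)) (B + 1) p" if "p \<in> P" for p
    using B(2) that norm_fst_le[of "fst p" "snd p"] norm_snd_le[of "snd p" "fst p"]
    by (auto simp: abs_le_iff dest!: bspec)
  then show ?thesis using that[of "B + 1"] B(1) by simp
qed

theorem theorem5:
  fixes V :: "'a set" and E :: "'a set set" and P :: "point set"
  assumes "is_tree V E"
    and "max_degree_le V E 4"
    and "finite P"
    and "general_orthogonal_position P"
    and "real (card P) \<ge> 2 * real (card V) powr 1.55"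
  shows "has_planar_L_drawing V E P"
proof -
  obtain t where t: "distinct_tr t" "t \<noteq> Lf" "set_tr t = V" "E = (\<lambda>(u, v). {u, v}) ` tr_edges t"
    using tree_as_tr[OF assms(1,2)] by blast
  have "sufficient t (card P)"
    using assms(5) size_distinct_tr[OF t(1)] by (intro sufficient_size) (simp add: t(3))
  moreover obtain B where B: "0 < B" "\<forall>p\<in>P. inbox (- B) B (- B) B p"
    by (rule finite_points_in_box[OF assms(3)])
  \<comment> \<open>The whole tree hangs from an auxiliary point on the left side of the box, at a
    height that no point of \<open>P\<close> has.\<close>
  moreover obtain y where y: "- B < y" "y < B" "y \<notin> snd ` P"
    by (rule dense_avoid[of "snd ` P" "- B" B]) (use assms(3) B(1) in auto)
  ultimately have "\<exists>Q. hung t (- B, y) P Q \<and>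
    (\<forall>q\<in>Q. snd q = snd (- B, y) \<and> fst (- B, y) < fst q \<and> fst q \<le> - B \<or> inbox (- B) B (- B) B q)"
    using assms(3,4) by (intro sufficient_right[where N = "card P"]) auto
  then obtain Q where "hung t (- B, y) P Q" by blast
  from drawing_of_hung[OF this t(1,2)] show ?thesis by (simp add: t(3,4))
qed

end
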